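(* The set $\mathrm{EXL}^*=\{e\in\mathbb N : \mathcal L_e \text{ is TxtEx}^*\text{-learnable}\}$, where $\mathcal L_e$ is the uniformly computably enumerable family coded by $e$, is a $\Sigma^0_5$ set (that is, it has a $\Sigma_5^0$ description).
   Context: Fix a computable pairing function $\langle\cdot,\cdot\rangle:\mathbb N^2\to\mathbb N$ and a standard numbering $W_0,W_1,\dots$ of the computably enumerable (c.e.) sets. A number $e$ codes the uniformly computably enumerable (u.c.e.) family $\mathcal L_e=\{L_0,L_1,\dots\}$ whose $i$-th member (column) is $L_i=\{x:\langle i,x\rangle\in W_e\}$; the u.c.e. families are exactly those of this form. Write $A=^*B$ if the symmetric difference $A\triangle B$ is finite. An enumeration is a function $f:\mathbb N\to\mathbb N$; $\mathrm{content}(f)=\{x:(\exists n)\,f(n)=x\}$; $f$ is an enumeration of (for) a set $A$ if $\mathrm{content}(f)=A$. $f\upharpoonright i$ is the initial segment of $f$ of length $i$, a finite string of natural numbers. A learning machine is a (possibly partial) computable function $M$ from finite strings of natural numbers to $\mathbb N$; a statement about a value of $M$ includes that this value is defined. $M$ TxtEx$^*$-identifies an enumeration $f$ if there is $n$ such that $\lim_{i\to\infty}M(f\upharpoonright i)=n$ (i.e. $M(f\upharpoonright i)=n$ for all sufficiently large $i$) and $W_n=^*\mathrm{content}(f)$. $M$ TxtEx$^*$-learns a c.e. set $A$ if it TxtEx$^*$-identifies every enumeration of $A$. $M$ TxtEx$^*$-learns a family of c.e. sets if it TxtEx$^*$-learns every member of the family. A family is TxtEx$^*$-learnable if some learning machine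 TxtEx$^*$-learns it. *)

theory Defs
  imports Complex_Main "HOL-Library.Nat_Bijection"
begin

section \<open>Partial recursive functions\<close>

datatype recf =
    Zero
  | Succ
  | Proj nat
  | Comp recf "recf list"
  | PrimRec recf recf
  | Mu recf

text \<open>
  The terms carry no arity; a term is run on an argument list of any length, and an application
  with the wrong number of arguments is undefined. The recursion and search variables come first.
  The value of \<open>Mu f\<close> is the least \<open>n\<close> with \<open>f (n, xs) = 0\<close>, and it is
  defined only if \<open>f\<close> is defined on all smaller values as well.
\<close>

fun eval :: "recf \<Rightarrow> nat list \<Rightarrow> nat option" where
  "eval Zero xs = Some 0"
| "eval Succ xs = (case xs of [x] \<Rightarrow> Some (Suc x) | _ \<Rightarrow> None)"
| "eval (Proj i) xs = (if i < length xs then Some (xs ! i) else None)"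
| "eval (Comp f gs) xs =
     (let ys = map (\<lambda>g. eval g xs) gs
      in if None \<in> set ys then None else eval f (map the ys))"
| "eval (PrimRec f g) [] = None"
| "eval (PrimRec f g) (0 # xs) = eval f xs"
| "eval (PrimRec f g) (Suc n # xs) =
     (case eval (PrimRec f g) (n # xs) of
        None \<Rightarrow> None
      | Some y \<Rightarrow> eval g (n # y # xs))"
| "eval (Mu f) xs =
     (if \<exists>n. eval f (n # xs) = Some 0 \<and> (\<forall>m<n. eval f (m # xs) \<noteq> None)
      then Some (LEAST n. eval f (n # xs) = Some 0)
      else None)"

definition computable1 :: "(nat \<Rightarrow> nat) \<Rightarrow> bool" where
  "computable1 f \<longleftrightarrow> (\<exists>r. \<forall>x. eval r [x] = Some (f x))"

definition computable2 :: "(nat \<Rightarrow> nat \<Rightarrow> nat) \<Rightarrow> bool" where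
  "computable2 f \<longleftrightarrow> (\<exists>r. \<forall>x y. eval r [x, y] = Some (f x y))"

definition decidable :: "nat \<Rightarrow> (nat list \<Rightarrow> bool) \<Rightarrow> bool" where
  "decidable k R \<longleftrightarrow>
     (\<exists>r. \<forall>xs. length xs = k \<longrightarrow> eval r xs = Some (if R xs then 1 else 0))"


section \<open>The arithmetical hierarchy\<close>

text \<open>
  \<open>alternation True n R xs\<close> is \<open>\<exists>y\<^sub>1. \<forall>y\<^sub>2. \<exists>y\<^sub>3. \<dots> R (xs, y\<^sub>1, \<dots>, y\<^sub>n)\<close>, with \<open>n\<close> alternating
  quantifiers; with \<open>False\<close> the block starts with a universal quantifier.
\<close>

fun alternation :: "bool \<Rightarrow> nat \<Rightarrow> (nat list \<Rightarrow> bool) \<Rightarrow> nat list \<Rightarrow> bool" where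
  "alternation b 0 R xs \<longleftrightarrow> R xs"
| "alternation True (Suc n) R xs \<longleftrightarrow> (\<exists>y. alternation False n R (xs @ [y]))"
| "alternation False (Suc n) R xs \<longleftrightarrow> (\<forall>y. alternation True n R (xs @ [y]))"

definition Sigma0 :: "nat \<Rightarrow> nat set \<Rightarrow> bool" where
  "Sigma0 n A \<longleftrightarrow>
     (\<exists>R. decidable (Suc n) R \<and> (\<forall>x. x \<in> A \<longleftrightarrow> alternation True n R [x]))"


section \<open>Numberings of the c.e. sets and u.c.e. families\<close>

definition uniformly_ce :: "(nat \<Rightarrow> nat set) \<Rightarrow> bool" where
  "uniformly_ce V \<longleftrightarrow> (\<exists>r. \<forall>i x. x \<in> V i \<longleftrightarrow> eval r [i, x] \<noteq> None)"

text \<open>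
  The standard numberings are taken to be all acceptable ones: those that are uniformly c.e. and
  to which every uniformly c.e. sequence reduces computably (the s-m-n property). The range of such
  a numbering is exactly the class of c.e. sets.
\<close>

definition standard_numbering :: "(nat \<Rightarrow> nat set) \<Rightarrow> bool" where
  "standard_numbering W \<longleftrightarrow>
     uniformly_ce W \<and>
     (\<forall>V. uniformly_ce V \<longrightarrow> (\<exists>f. computable1 f \<and> (\<forall>i. W (f i) = V i)))"

definition pairing_function :: "(nat \<Rightarrow> nat \<Rightarrow> nat) \<Rightarrow> bool" where
  "pairing_function p \<longleftrightarrow>
     computable2 p \<and> (\<forall>i x j y. p i x = p j y \<longrightarrow> i = j \<and> x = y)"

definition column ::
  "(nat \<Rightarrow> nat \<Rightarrow> nat) \<Rightarrow> (nat \<Rightarrow> nat set) \<Rightarrow> nat \<Rightarrow> nat \<Rightarrow> nat set" where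
  "column p W e i = {x. p i x \<in> W e}"

definition uce_family ::
  "(nat \<Rightarrow> nat \<Rightarrow> nat) \<Rightarrow> (nat \<Rightarrow> nat set) \<Rightarrow> nat \<Rightarrow> nat set set" where
  "uce_family p W e = range (column p W e)"


section \<open>Learning\<close>

definition eq_star :: "nat set \<Rightarrow> nat set \<Rightarrow> bool" where
  "eq_star A B \<longleftrightarrow> finite (sym_diff A B)"

definition initial_segment :: "(nat \<Rightarrow> nat) \<Rightarrow> nat \<Rightarrow> nat list" where
  "initial_segment f i = map f [0..<i]"

definition learning_machine :: "(nat list \<Rightarrow> nat option) \<Rightarrow> bool" where
  "learning_machine M \<longleftrightarrow> (\<exists>r. \<forall>s. eval r [list_encode s] = M s)"

definition TxtEx_star_identifies ::
  "(nat \<Rightarrow> nat set) \<Rightarrow> (nat list \<Rightarrow> nat option) \<Rightarrow> (nat \<Rightarrow> nat) \<Rightarrow> bool" where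
  "TxtEx_star_identifies W M f \<longleftrightarrow>
     (\<exists>n. (\<forall>\<^sub>F i in sequentially. M (initial_segment f i) = Some n) \<and> eq_star (W n) (range f))"

text \<open>
  Enumerations are total functions, so the empty set has none and is learned by every machine.
\<close>

definition TxtEx_star_learns_set ::
  "(nat \<Rightarrow> nat set) \<Rightarrow> (nat list \<Rightarrow> nat option) \<Rightarrow> nat set \<Rightarrow> bool" where
  "TxtEx_star_learns_set W M A \<longleftrightarrow> (\<forall>f. range f = A \<longrightarrow> TxtEx_star_identifies W M f)"

definition TxtEx_star_learns_family ::
  "(nat \<Rightarrow> nat set) \<Rightarrow> (nat list \<Rightarrow> nat option) \<Rightarrow> nat set set \<Rightarrow> bool" where
  "TxtEx_star_learns_family W M F \<longleftrightarrow> (\<forall>A\<in>F. TxtEx_star_learns_set W M A)"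

definition TxtEx_star_learnable :: "(nat \<Rightarrow> nat set) \<Rightarrow> nat set set \<Rightarrow> bool" where
  "TxtEx_star_learnable W F \<longleftrightarrow> (\<exists>M. learning_machine M \<and> TxtEx_star_learns_family W M F)"

definition EXL_star :: "(nat \<Rightarrow> nat \<Rightarrow> nat) \<Rightarrow> (nat \<Rightarrow> nat set) \<Rightarrow> nat set" where
  "EXL_star p W = {e. TxtEx_star_learnable W (uce_family p W e)}"

end

(*
  Call a sequence s over A stabilizing for a total machine N if N does not change its mind on any
  extension of s over A. If N learns A, then a stabilizing sequence exists (a locking-sequence
  argument), and N(s) is a correct hypothesis for every such s, provided A is nonempty. Conversely,
  if a stabilizing sequence exists and all of them carry correct hypotheses, then A is learned by
  the machine that guesses the least sequence not yet seen to fail to be stabilizing.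

  Machines are indexed by the numbering itself: M is recovered in the limit from an index of its
  graph, by a total machine N_a that answers with the value at the longest prefix of the input on
  which convergence is already visible. Hence e is in EXL* iff
    for some a and all i, (1) a stabilizing c for N_a on the i-th column L_i exists, and
    (2) for all stabilizing c and all x in L_i, the set W_{N_a(c)} is a finite variant of L_i.
  Being stabilizing is Delta_2 and being a finite variant is Sigma_3, so (1) and (2) are Pi_4.

  For the numbering to have decidable stages, every single program needs a clocked version, which
  is built by induction on the program; no universal program is needed.
*)
theory Submission
  imports Defs "HOL-Library.Sublist"
begin

section \<open>Total computable functions\<close>

text \<open>The graph of a machine, not its program, gets the index: quantifying over programs would
  require coding them and a universal evaluator, whereas one clocked program for the uniform
  sequence \<open>W\<close> supplies stages for all indices at once. Every number a gives a total
  recursive N_a, whether or not W_a is the graph of a machine; so a simply ranges over all numbers,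
  and the learner can compare values of N_a without waiting for convergence. Clause (2) speaks of
  all stabilizing sequences because the learner settles on the least one, whichever that is; a
  single correct one among several would not help it. The guard x in L_i is there for an empty
  column: it has no enumeration, hence is learned vacuously, and the hypothesis N_a([]) may well be
  wrong. Being stabilizing is a Sigma_1 condition (the entries lie in A) joined to a Pi_1 condition,
  so it can also stand as the premise of an implication whose conclusion is Sigma_3. Finite variance
  is the costly ingredient: x, c and i together add one alternation to its Sigma_3, and a adds the
  last one.\<close>

definition total_rec :: "nat \<Rightarrow> (nat list \<Rightarrow> nat) \<Rightarrow> bool" where
  "total_rec k f \<longleftrightarrow> (\<exists>r. \<forall>xs. length xs = k \<longrightarrow> eval r xs = Some (f xs))"

lemma total_rec_cong:
  "(\<And>xs. length xs = k \<Longrightarrow> f xs = g xs) \<Longrightarrow> total_rec k f \<longleftrightarrow> total_rec k g"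
  by (simp add: total_rec_def)

lemma decidable_iff_total_rec: "decidable k R \<longleftrightarrow> total_rec k (\<lambda>xs. if R xs then 1 else 0)"
  by (simp add: decidable_def total_rec_def)

lemma decidable_cong:
  "(\<And>xs. length xs = k \<Longrightarrow> P xs = Q xs) \<Longrightarrow> decidable k P \<longleftrightarrow> decidable k Q"
  by (simp add: decidable_def)

lemma total_rec_nth: "i < k \<Longrightarrow> total_rec k (\<lambda>xs. xs ! i)"
  unfolding total_rec_def by (rule exI[of _ "Proj i"]) simp

lemma total_rec_comp:
  assumes "total_rec (length gs) F" and "\<And>g. g \<in> set gs \<Longrightarrow> total_rec k g"
  shows "total_rec k (\<lambda>xs. F (map (\<lambda>g. g xs) gs))"
proof -
  obtain r where r: "\<And>xs. length xs = length gs \<Longrightarrow> eval r xs = Some (F xs)"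
    using assms(1) unfolding total_rec_def by blast
  have "\<forall>g\<in>set gs. \<exists>r. \<forall>xs. length xs = k \<longrightarrow> eval r xs = Some (g xs)"
    using assms(2) unfolding total_rec_def by blast
  then obtain q where q: "\<And>g xs. g \<in> set gs \<Longrightarrow> length xs = k \<Longrightarrow> eval (q g) xs = Some (g xs)"
    by metis
  have "eval (Comp r (map q gs)) xs = Some (F (map (\<lambda>g. g xs) gs))" if "length xs = k" for xs
  proof -
    have "map (\<lambda>g. eval g xs) (map q gs) = map (\<lambda>g. Some (g xs)) gs"
      using q that by simp
    moreover have "None \<notin> set (map (\<lambda>g. Some (g xs)) gs)" by auto
    ultimately have "eval (Comp r (map q gs)) xs = eval r (map the (map (\<lambda>g. Some (g xs)) gs))"
      by (simp only: eval.simps Let_def if_False)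
    then show ?thesis by (simp add: r o_def)
  qed
  then show ?thesis unfolding total_rec_def by blast
qed

lemma total_rec_comp1:
  assumes "total_rec 1 (\<lambda>xs. F (xs ! 0))" "total_rec k f"
  shows "total_rec k (\<lambda>xs. F (f xs))"
  using total_rec_comp[of "[f]" "\<lambda>xs. F (xs ! 0)" k] assms by simp

lemma total_rec_comp2:
  assumes "total_rec 2 (\<lambda>xs. F (xs ! 0) (xs ! 1))" "total_rec k f" "total_rec k g"
  shows "total_rec k (\<lambda>xs. F (f xs) (g xs))"
  using total_rec_comp[of "[f, g]" "\<lambda>xs. F (xs ! 0) (xs ! 1)" k] assms
  by (auto simp: numeral_2_eq_2)

lemma total_rec_comp3:
  assumes "total_rec 3 (\<lambda>xs. F (xs ! 0) (xs ! 1) (xs ! 2))"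
    and "total_rec k f" "total_rec k g" "total_rec k h"
  shows "total_rec k (\<lambda>xs. F (f xs) (g xs) (h xs))"
  using total_rec_comp[of "[f, g, h]" "\<lambda>xs. F (xs ! 0) (xs ! 1) (xs ! 2)" k] assms
  by (auto simp: numeral_2_eq_2 numeral_3_eq_3)

lemma decidable_comp3:
  assumes "decidable 3 (\<lambda>xs. P (xs ! 0) (xs ! 1) (xs ! 2))"
    and "total_rec k f" "total_rec k g" "total_rec k h"
  shows "decidable k (\<lambda>xs. P (f xs) (g xs) (h xs))"
  using total_rec_comp3[of "\<lambda>x y z. if P x y z then 1 else 0"] assms
  by (simp add: decidable_iff_total_rec)

lemma decidable_comp:
  assumes "decidable (length gs) P" and "\<And>g. g \<in> set gs \<Longrightarrow> total_rec k g"
  shows "decidable k (\<lambda>xs. P (map (\<lambda>g. g xs) gs))"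
  using total_rec_comp[of gs "\<lambda>xs. if P xs then 1 else 0"] assms
  by (simp add: decidable_iff_total_rec)

lemma total_rec_Suc: "total_rec k f \<Longrightarrow> total_rec k (\<lambda>xs. Suc (f xs))"
proof (rule total_rec_comp1[of Suc])
  have "\<forall>xs. length xs = 1 \<longrightarrow> eval Succ xs = Some (Suc (xs ! 0))"
    by (auto simp: length_Suc_conv)
  then show "total_rec 1 (\<lambda>xs. Suc (xs ! 0))" unfolding total_rec_def by blast
qed

lemma total_rec_const: "total_rec k (\<lambda>_. c)"
proof (induction c)
  case 0
  then show ?case unfolding total_rec_def by (rule exI[of _ Zero]) simp
qed (rule total_rec_Suc)

lemma total_rec_rearrange:
  assumes "total_rec m F" "length is = m" "\<And>i. i \<in> set is \<Longrightarrow> i < k"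
  shows "total_rec k (\<lambda>xs. F (map ((!) xs) is))"
  using total_rec_comp[of "map (\<lambda>i xs. xs ! i) is" F k] assms
  by (auto simp: comp_def intro: total_rec_nth)

lemma map_nth_upt: "length xs = n \<Longrightarrow> i \<le> n \<Longrightarrow> map ((!) xs) [i..<n] = drop i xs"
  by (rule nth_equalityI) auto

lemma map_nth_upt0: "n \<le> length xs \<Longrightarrow> map ((!) xs) [0..<n] = take n xs"
  by (rule nth_equalityI) auto

lemma total_rec_take:
  assumes "total_rec m F" "m \<le> k"
  shows "total_rec k (\<lambda>xs. F (take m xs))"
proof -
  have "total_rec k (\<lambda>xs. F (map ((!) xs) [0..<m]))"
    using total_rec_rearrange[of m F "[0..<m]" k] assms by auto
  then show ?thesis
    by (rule total_rec_cong[THEN iffD1, rotated]) (use assms in \<open>simp add: map_nth_upt0\<close>)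
qed

text \<open>\<open>PrimRec\<close> expects the counter and the previous value in front, while here,
  as in \<open>alternation\<close>, an added variable stands behind the parameters. Permuting
  arguments reconciles the two conventions.\<close>

lemma total_rec_rec_nat:
  assumes b: "total_rec k b" and f: "total_rec k f"
    and g: "total_rec (Suc (Suc k)) (\<lambda>zs. g (take k zs) (zs ! k) (zs ! Suc k))"
  shows "total_rec k (\<lambda>xs. rec_nat (f xs) (\<lambda>n y. g xs n y) (b xs))"
proof -
  obtain rf where rf: "\<And>xs. length xs = k \<Longrightarrow> eval rf xs = Some (f xs)"
    using f unfolding total_rec_def by blast
  \<comment> \<open>The index list sends positions 0 and 1, where \<open>PrimRec\<close> puts
    counter and previous value, behind the parameters.\<close>
  have "total_rec (Suc (Suc k)) (\<lambda>zs. (\<lambda>zs. g (take k zs) (zs ! k) (zs ! Suc k)) (map ((!) zs) ([2..<Suc (Suc k)] @ [0, 1])))"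
    by (rule total_rec_rearrange[OF g]) auto
  then have "total_rec (Suc (Suc k)) (\<lambda>zs. g (drop 2 zs) (zs ! 0) (zs ! 1))"
    by (rule total_rec_cong[THEN iffD1, rotated]) (auto simp: map_nth_upt nth_append simp del: upt_Suc)
  then obtain rg where rg: "\<And>xs. length xs = Suc (Suc k) \<Longrightarrow> eval rg xs = Some (g (drop 2 xs) (xs ! 0) (xs ! 1))"
    unfolding total_rec_def by blast
  have ev: "eval (PrimRec rf rg) (n # xs) = Some (rec_nat (f xs) (\<lambda>n y. g xs n y) n)"
    if "length xs = k" for n xs
    by (induction n) (use that rf rg in \<open>auto simp: numeral_2_eq_2\<close>)
  have "total_rec (Suc k) (\<lambda>zs. rec_nat (f (tl zs)) (\<lambda>n y. g (tl zs) n y) (hd zs))"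
    unfolding total_rec_def by (rule exI[of _ "PrimRec rf rg"]) (auto simp: length_Suc_conv ev)
  then have "total_rec (length (b # map (\<lambda>i xs. xs ! i) [0..<k]))
      (\<lambda>zs. rec_nat (f (tl zs)) (\<lambda>n y. g (tl zs) n y) (hd zs))" by simp
  moreover have "total_rec k h" if "h \<in> set (b # map (\<lambda>i xs. xs ! i) [0..<k])" for h
    using that b by (auto simp: total_rec_nth)
  ultimately have "total_rec k (\<lambda>xs. (\<lambda>zs. rec_nat (f (tl zs)) (\<lambda>n y. g (tl zs) n y) (hd zs))
      (map (\<lambda>h. h xs) (b # map (\<lambda>i xs. xs ! i) [0..<k])))"
    by (rule total_rec_comp)
  then
  have "total_rec k (\<lambda>xs. rec_nat (f (map ((!) xs) [0..<k])) (\<lambda>n y. g (map ((!) xs) [0..<k]) n y) (b xs))"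
    by (simp add: o_def)
  then show ?thesis
    by (rule total_rec_cong[THEN iffD1, rotated]) (simp add: map_nth_upt0)
qed

lemma total_rec_pred: "total_rec k f \<Longrightarrow> total_rec k (\<lambda>xs. f xs - 1)"
proof (rule total_rec_comp1[of "\<lambda>x. x - 1"])
  have "total_rec 1 (\<lambda>xs. rec_nat 0 (\<lambda>n y. n) (xs ! 0))"
    by (rule total_rec_rec_nat) (auto intro: total_rec_nth total_rec_const)
  moreover have "rec_nat 0 (\<lambda>n y. n) x = x - Suc 0" for x by (cases x) auto
  ultimately show "total_rec 1 (\<lambda>xs. xs ! 0 - 1)" by simp
qed

lemma total_rec_diff: "total_rec k f \<Longrightarrow> total_rec k g \<Longrightarrow> total_rec k (\<lambda>xs. f xs - g xs)"
proof (rule total_rec_comp2[of "\<lambda>x y. x - y"])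
  have "total_rec 2 (\<lambda>xs. rec_nat (xs ! 0) (\<lambda>n y. y - 1) (xs ! 1))"
    by (intro total_rec_rec_nat total_rec_nth total_rec_pred) auto
  moreover have "rec_nat x (\<lambda>n y. y - Suc 0) z = x - z" for x z by (induction z) auto
  ultimately show "total_rec 2 (\<lambda>xs. xs ! 0 - xs ! 1)" by simp
qed

lemma total_rec_add: "total_rec k f \<Longrightarrow> total_rec k g \<Longrightarrow> total_rec k (\<lambda>xs. f xs + g xs)"
proof (rule total_rec_comp2[of "\<lambda>x y. x + y"])
  have "total_rec 2 (\<lambda>xs. rec_nat (xs ! 0) (\<lambda>n y. Suc y) (xs ! 1))"
    by (intro total_rec_rec_nat total_rec_nth total_rec_Suc) auto
  moreover have "rec_nat x (\<lambda>n y. Suc y) z = x + z" for x z by (induction z) auto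
  ultimately show "total_rec 2 (\<lambda>xs. xs ! 0 + xs ! 1)" by simp
qed

lemma total_rec_mult: "total_rec k f \<Longrightarrow> total_rec k g \<Longrightarrow> total_rec k (\<lambda>xs. f xs * g xs)"
proof (rule total_rec_comp2[of "\<lambda>x y. x * y"])
  have "total_rec 2 (\<lambda>xs. rec_nat 0 (\<lambda>n y. y + take 2 xs ! 0) (xs ! 1))"
    by (intro total_rec_rec_nat total_rec_add total_rec_nth total_rec_const)
      (auto intro: total_rec_nth)
  moreover have "rec_nat 0 (\<lambda>n y. y + x) z = x * z" for x z by (induction z) auto
  ultimately show "total_rec 2 (\<lambda>xs. xs ! 0 * xs ! 1)" by simp
qed

section \<open>Decidable predicates, bounded quantifiers and search\<close>

lemma decidable_not: "decidable k P \<Longrightarrow> decidable k (\<lambda>xs. \<not> P xs)"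
  using total_rec_diff[OF total_rec_const[of k 1], of "\<lambda>xs. if P xs then 1 else 0"]
  by (auto simp: decidable_iff_total_rec intro: total_rec_cong[THEN iffD1, rotated])

lemma decidable_conj: "decidable k P \<Longrightarrow> decidable k Q \<Longrightarrow> decidable k (\<lambda>xs. P xs \<and> Q xs)"
  using total_rec_mult[of k "\<lambda>xs. if P xs then 1 else 0" "\<lambda>xs. if Q xs then 1 else 0"]
  by (auto simp: decidable_iff_total_rec intro: total_rec_cong[THEN iffD1, rotated])

lemma decidable_disj: "decidable k P \<Longrightarrow> decidable k Q \<Longrightarrow> decidable k (\<lambda>xs. P xs \<or> Q xs)"
  using decidable_not[of k "\<lambda>xs. \<not> P xs \<and> \<not> Q xs"] by (simp add: decidable_not decidable_conj)

lemma decidable_imp: "decidable k P \<Longrightarrow> decidable k Q \<Longrightarrow> decidable k (\<lambda>xs. P xs \<longrightarrow> Q xs)"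
  using decidable_disj[of k "\<lambda>xs. \<not> P xs" Q] by (simp add: decidable_not)

lemma decidable_le:
  assumes "total_rec k f" "total_rec k g"
  shows "decidable k (\<lambda>xs. f xs \<le> g xs)"
proof -
  have "(if f xs \<le> g xs then 1 else 0) = 1 - (f xs - g xs)" for xs by simp
  then show ?thesis
    unfolding decidable_iff_total_rec by (simp only: total_rec_diff total_rec_const assms)
qed

lemma decidable_less: "total_rec k f \<Longrightarrow> total_rec k g \<Longrightarrow> decidable k (\<lambda>xs. f xs < g xs)"
  using decidable_le[of k "\<lambda>xs. Suc (f xs)" g] by (simp add: total_rec_Suc Suc_le_eq)

lemma decidable_eq: "total_rec k f \<Longrightarrow> total_rec k g \<Longrightarrow> decidable k (\<lambda>xs. f xs = g xs)"
  using decidable_conj[OF decidable_le[of k f g] decidable_le[of k g f]]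
  by (simp add: order_antisym_conv order_eq_iff)

lemma total_rec_if:
  assumes "decidable k P" "total_rec k f" "total_rec k g"
  shows "total_rec k (\<lambda>xs. if P xs then f xs else g xs)"
proof -
  have "total_rec k (\<lambda>xs. (if P xs then 1 else 0) * f xs + (if \<not> P xs then 1 else 0) * g xs)"
    by (intro total_rec_add total_rec_mult assms decidable_not
        decidable_iff_total_rec[THEN iffD1])
  then show ?thesis by (rule total_rec_cong[THEN iffD1, rotated]) auto
qed

text \<open>Primitive recursion on the bound, with a 0/1 flag as the accumulated value.\<close>

lemma decidable_bex:
  assumes "total_rec k b" "decidable (Suc k) (\<lambda>zs. P (take k zs) (zs ! k))"
  shows "decidable k (\<lambda>xs. \<exists>n<b xs. P xs n)"
proof -
  \<comment> \<open>The recursion step receives two extra entries, counter and flag; the predicate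
    is made to ignore the flag.\<close>
  have "decidable (Suc (Suc k)) (\<lambda>zs. P (take k (take (Suc k) zs)) (take (Suc k) zs ! k))"
    using total_rec_take[of "Suc k" _ "Suc (Suc k)"] assms(2)
    by (simp only: decidable_iff_total_rec) force
  then have "decidable (Suc (Suc k)) (\<lambda>zs. P (take k zs) (zs ! k))" by simp
  then have "total_rec k (\<lambda>xs. rec_nat 0 (\<lambda>n y. if P xs n then 1 else y) (b xs))"
    by (intro total_rec_rec_nat assms(1) total_rec_const total_rec_if total_rec_nth) auto
  moreover have "rec_nat 0 (\<lambda>n y. if P xs n then 1 else y) m = (if \<exists>n<m. P xs n then 1 else 0::nat)" for xs m
    by (induction m) (auto simp: less_Suc_eq)
  ultimately show ?thesis by (simp add: decidable_iff_total_rec)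
qed

lemma decidable_ball:
  assumes "total_rec k b" "decidable (Suc k) (\<lambda>zs. P (take k zs) (zs ! k))"
  shows "decidable k (\<lambda>xs. \<forall>n<b xs. P xs n)"
  using decidable_not[OF decidable_bex[OF assms(1), of "\<lambda>xs n. \<not> P xs n"]] assms(2)
  by (simp add: decidable_not)

lemma decidable_bex_le:
  assumes "total_rec k b" "decidable (Suc k) (\<lambda>zs. P (take k zs) (zs ! k))"
  shows "decidable k (\<lambda>xs. \<exists>n\<le>b xs. P xs n)"
  using decidable_bex[OF total_rec_Suc[OF assms(1)] assms(2)] by (simp add: less_Suc_eq_le)

lemma decidable_ball_le:
  assumes "total_rec k b" "decidable (Suc k) (\<lambda>zs. P (take k zs) (zs ! k))"
  shows "decidable k (\<lambda>xs. \<forall>n\<le>b xs. P xs n)"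
  using decidable_ball[OF total_rec_Suc[OF assms(1)] assms(2)] by (simp add: less_Suc_eq_le)

lemma decidable_rotate:
  assumes "decidable (Suc k) (\<lambda>zs. P (take k zs) (zs ! k))"
  shows "decidable (Suc k) (\<lambda>zs. P (tl zs) (hd zs))"
proof -
  have "total_rec (Suc k) (\<lambda>zs. (\<lambda>zs. if P (take k zs) (zs ! k) then 1 else 0) (map ((!) zs) ([1..<Suc k] @ [0])))"
    by (rule total_rec_rearrange[OF assms[unfolded decidable_iff_total_rec]]) auto
  then show ?thesis unfolding decidable_iff_total_rec
    apply (rule total_rec_cong[THEN iffD1, rotated]) 
    subgoal for xs by (cases xs) (auto simp: map_nth_upt nth_append simp del: upt_Suc)
    done
qed

text \<open>\<open>Mu\<close> looks for a zero and has its variable in front, so it is applied to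
  the 0/1 function of the negated, rotated predicate. That function is total, hence no earlier
  candidate blocks the search.\<close>

lemma semidecidable_Mu:
  assumes "decidable (Suc k) (\<lambda>zs. P (take k zs) (zs ! k))"
  obtains r where "\<And>xs. length xs = k \<Longrightarrow>
    eval r xs = (if \<exists>y. P xs y then Some (LEAST y. P xs y) else None)"
proof -
  from decidable_not[OF decidable_rotate[OF assms]]
  obtain r where r: "\<And>zs. length zs = Suc k \<Longrightarrow> eval r zs = Some (if \<not> P (tl zs) (hd zs) then 1 else 0)"
    unfolding decidable_def by blast
  have "eval (Mu r) xs = (if \<exists>y. P xs y then Some (LEAST y. P xs y) else None)" if "length xs = k" for xs
    using that by (simp add: r)
  then show thesis by (rule that)
qed

lemma total_rec_Least:
  assumes "decidable (Suc k) (\<lambda>zs. P (take k zs) (zs ! k))"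
    and "\<And>xs. length xs = k \<Longrightarrow> \<exists>y. P xs y"
  shows "total_rec k (\<lambda>xs. LEAST y. P xs y)"
proof -
  obtain r where "\<And>xs. length xs = k \<Longrightarrow>
      eval r xs = (if \<exists>y. P xs y then Some (LEAST y. P xs y) else None)"
    using semidecidable_Mu[where P = P, OF assms(1)] by metis
  then show ?thesis using assms(2) unfolding total_rec_def by (intro exI[of _ r]) auto
qed

lemmas total_rec_intros =
  total_rec_const total_rec_Suc total_rec_pred total_rec_add total_rec_mult total_rec_diff
  total_rec_if total_rec_nth
lemmas decidable_intros =
  decidable_not decidable_conj decidable_disj decidable_imp decidable_le decidable_less
  decidable_eq decidable_bex decidable_ball decidable_bex_le decidable_ball_le

section \<open>Clocked evaluation\<close>


lemma total_rec_clocked_comp: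
  assumes "total_rec (Suc (length gs)) (\<lambda>zs. c (zs ! length gs) (take (length gs) zs))"
    and "total_rec k tf" "\<And>g. g \<in> set gs \<Longrightarrow> total_rec k g"
  shows "total_rec k (\<lambda>xs. c (tf xs) (map (\<lambda>g. g xs) gs))"
  using total_rec_comp[of "gs @ [tf]" "\<lambda>zs. c (zs ! length gs) (take (length gs) zs)" k] assms
  by (auto simp: nth_append)

text \<open>
  \<open>c t xs\<close> is \<open>0\<close> while no value has been found at stage \<open>t\<close>, and \<open>Suc y\<close> once the value \<open>y\<close> is known.
\<close>

definition clocked_eval :: "nat \<Rightarrow> recf \<Rightarrow> (nat \<Rightarrow> nat list \<Rightarrow> nat) \<Rightarrow> bool" where
  "clocked_eval k r c \<longleftrightarrow>
     total_rec (Suc k) (\<lambda>zs. c (zs ! k) (take k zs)) \<and>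
     (\<forall>xs. length xs = k \<longrightarrow>
        (\<forall>t t'. c t xs \<noteq> 0 \<longrightarrow> t \<le> t' \<longrightarrow> c t' xs = c t xs) \<and>
        (\<forall>y. eval r xs = Some y \<longleftrightarrow> (\<exists>t. c t xs = Suc y)))"


lemma
  assumes "clocked_eval k r c"
  shows clocked_eval_total: "total_rec (Suc k) (\<lambda>zs. c (zs ! k) (take k zs))"
    and clocked_eval_mono: "length xs = k \<Longrightarrow> c t xs \<noteq> 0 \<Longrightarrow> t \<le> t' \<Longrightarrow> c t' xs = c t xs"
    and clocked_eval_Some: "length xs = k \<Longrightarrow> eval r xs = Some y \<longleftrightarrow> (\<exists>t. c t xs = Suc y)"
  using assms unfolding clocked_eval_def by blast+

lemma decidable_const: "decidable k (\<lambda>_. b)"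
  by (cases b) (simp_all add: decidable_iff_total_rec total_rec_const)

lemma decidable_ball_set:
  "(\<And>g. g \<in> set gs \<Longrightarrow> decidable k (P g)) \<Longrightarrow> decidable k (\<lambda>xs. \<forall>g\<in>set gs. P g xs)"
  by (induction gs) (auto simp: decidable_const intro: decidable_conj)

lemma total_rec_clocked:
  assumes "total_rec (Suc m) (\<lambda>zs. c (zs ! m) (take m zs))"
    and "total_rec k tf" "\<And>g. g \<in> set gs \<Longrightarrow> total_rec k g" "length gs = m"
    and "\<And>xs. length xs = k \<Longrightarrow> h xs = c (tf xs) (map (\<lambda>g. g xs) gs)"
  shows "total_rec k h"
  using total_rec_clocked_comp[of gs c k tf] assms
  by (auto intro: total_rec_cong[THEN iffD1, rotated])

text \<open>Inner and outer clocks share one stage. Found values never change, so the finitely many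
  stages at which the pieces converge can be replaced by their maximum; \<open>- 1\<close> strips
  the \<open>Suc\<close> that marks a found value.\<close>

lemma clocked_eval_Comp:
  assumes "\<And>g. g \<in> set gs \<Longrightarrow> clocked_eval k g (C g)" and "clocked_eval (length gs) f cf"
  shows "clocked_eval k (Comp f gs)
    (\<lambda>t xs. if \<forall>g\<in>set gs. C g t xs \<noteq> 0 then cf t (map (\<lambda>g. C g t xs - 1) gs) else 0)"
    (is "clocked_eval _ _ ?c")
  unfolding clocked_eval_def
proof (intro conjI allI impI)
  have C: "total_rec (Suc k) (\<lambda>zs. C g (zs ! k) (take k zs))" if "g \<in> set gs" for g
    using assms(1)[OF that] by (rule clocked_eval_total)
  show "total_rec (Suc k) (\<lambda>zs. ?c (zs ! k) (take k zs))"
  proof (intro total_rec_if decidable_ball_set decidable_not decidable_eq C total_rec_const)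
    show "total_rec (Suc k) (\<lambda>zs. cf (zs ! k) (map (\<lambda>g. C g (zs ! k) (take k zs) - 1) gs))"
      by (rule total_rec_clocked[where m = "length gs" and c = cf and tf = "\<lambda>zs. zs ! k"
            and gs = "map (\<lambda>g zs. C g (zs ! k) (take k zs) - 1) gs"])
        (use clocked_eval_total[OF assms(2)] C in
          \<open>auto simp: o_def intro: total_rec_nth total_rec_pred[simplified]\<close>)
  qed
next
  fix xs :: "nat list" and t t' assume xs: "length xs = k" and nz: "?c t xs \<noteq> 0" and le: "t \<le> t'"
  have eq: "C g t' xs = C g t xs" "C g t xs \<noteq> 0" if "g \<in> set gs" for g
    using clocked_eval_mono[OF assms(1)[OF that] xs _ le] nz that by (metis (lifting))+
  then have "map (\<lambda>g. C g t' xs - 1) gs = map (\<lambda>g. C g t xs - 1) gs" by simp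
  then show "?c t' xs = ?c t xs"
    using clocked_eval_mono[OF assms(2) _ _ le, of "map (\<lambda>g. C g t xs - 1) gs"] nz eq
    by (auto simp del: map_eq_conv split: if_splits)
next
  fix xs :: "nat list" and y assume xs: "length xs = k"
  show "(eval (Comp f gs) xs = Some y) = (\<exists>t. ?c t xs = Suc y)"
  proof
    assume ev: "eval (Comp f gs) xs = Some y"
    moreover have "eval (Comp f gs) xs = (if None \<in> (\<lambda>g. eval g xs) ` set gs then None
        else eval f (map (\<lambda>g. the (eval g xs)) gs))"
      by (simp add: Let_def o_def)
    ultimately have nNone: "None \<notin> (\<lambda>g. eval g xs) ` set gs"
      and evf: "eval f (map (\<lambda>g. the (eval g xs)) gs) = Some y"
      by (metis option.distinct(1))+
    have def: "eval g xs \<noteq> None" if "g \<in> set gs" for g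
      using nNone that by (metis image_eqI)
    have "\<exists>t. C g t xs = Suc (the (eval g xs))" if "g \<in> set gs" for g
      using clocked_eval_Some[OF assms(1)[OF that] xs] def[OF that] by (metis option.collapse)
    then obtain T where T: "\<And>g. g \<in> set gs \<Longrightarrow> C g (T g) xs = Suc (the (eval g xs))" by metis
    obtain t0 where t0: "cf t0 (map (\<lambda>g. the (eval g xs)) gs) = Suc y"
      using clocked_eval_Some[OF assms(2)] evf by auto
    define t where "t = Max (insert t0 (T ` set gs))"
    have Ct: "C g t xs = Suc (the (eval g xs))" if "g \<in> set gs" for g
    proof -
      have "T g \<le> t" unfolding t_def using that by (intro Max_ge) auto
      then show ?thesis using clocked_eval_mono[OF assms(1)[OF that] xs, of "T g" t] T[OF that] by simp
    qed
    have "map (\<lambda>g. C g t xs - 1) gs = map (\<lambda>g. the (eval g xs)) gs" using Ct by simp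
    moreover have "cf t (map (\<lambda>g. the (eval g xs)) gs) = Suc y"
      using clocked_eval_mono[OF assms(2), of _ t0 t] t0 by (simp add: t_def)
    ultimately have "?c t xs = Suc y" using Ct by (simp del: map_eq_conv)
    then show "\<exists>t. ?c t xs = Suc y" ..
  next
    assume "\<exists>t. ?c t xs = Suc y"
    then obtain t where nz: "\<forall>g\<in>set gs. C g t xs \<noteq> 0"
      and y: "cf t (map (\<lambda>g. C g t xs - 1) gs) = Suc y"
      by (auto split: if_splits)
    have ev: "eval g xs = Some (C g t xs - 1)" if "g \<in> set gs" for g
      using clocked_eval_Some[OF assms(1)[OF that] xs] nz that
      by (metis One_nat_def Suc_pred not_gr_zero)
    have "map (\<lambda>g. eval g xs) gs = map (\<lambda>g. Some (C g t xs - 1)) gs" using ev by simp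
    moreover have "None \<notin> set (map (\<lambda>g. Some (C g t xs - 1)) gs)" by auto
    ultimately have "eval (Comp f gs) xs = eval f (map the (map (\<lambda>g. Some (C g t xs - 1)) gs))"
      by (simp only: eval.simps Let_def if_False)
    also have "\<dots> = Some y"
      using clocked_eval_Some[OF assms(2)] y by (auto simp: o_def)
    finally show "eval (Comp f gs) xs = Some y" .
  qed
qed

lemma map_nth_take_upt: "k \<le> m \<Longrightarrow> map ((!) (take m xs)) [i..<k] = map ((!) xs) [i..<k]"
  by (rule map_cong) auto

text \<open>The intermediate values are clocked too: 0 means that some earlier value is still
  unknown at stage \<open>t\<close>, and it propagates upwards. For fixed \<open>t\<close> this is
  an ordinary total recursion on the first argument.\<close>

lemma clocked_eval_PrimRec:
  assumes f: "clocked_eval k f cf" and g: "clocked_eval (Suc (Suc k)) g cg"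
  defines "c \<equiv> \<lambda>t xs. rec_nat (cf t (tl xs))
      (\<lambda>m y. if y = 0 then 0 else cg t (m # (y - 1) # tl xs)) (hd xs)"
  shows "clocked_eval (Suc k) (PrimRec f g) c"
  unfolding clocked_eval_def
proof (intro conjI allI impI)
  have "total_rec (Suc (Suc k)) (\<lambda>zs. rec_nat (cf (zs ! Suc k) (map ((!) zs) [1..<Suc k]))
      (\<lambda>m y. if y = 0 then 0 else cg (zs ! Suc k) (m # (y - 1) # map ((!) zs) [1..<Suc k])) (zs ! 0))"
  proof (intro total_rec_rec_nat total_rec_if decidable_eq total_rec_const total_rec_nth)
    show "total_rec (Suc (Suc k)) (\<lambda>zs. cf (zs ! Suc k) (map ((!) zs) [1..<Suc k]))"
      by (rule total_rec_clocked[where m = k and c = cf and tf = "\<lambda>zs. zs ! Suc k"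
            and gs = "map (\<lambda>i zs. zs ! i) [1..<Suc k]"])
        (use clocked_eval_total[OF assms(1)] in \<open>auto simp: o_def intro: total_rec_nth\<close>)
    show "total_rec (Suc (Suc (Suc (Suc k)))) (\<lambda>zs. cg (take (Suc (Suc k)) zs ! Suc k)
        (zs ! Suc (Suc k) # (zs ! Suc (Suc (Suc k)) - 1) # map ((!) (take (Suc (Suc k)) zs)) [1..<Suc k]))"
      by (rule total_rec_clocked[where m = "Suc (Suc k)" and c = cg and tf = "\<lambda>zs. zs ! Suc k"
            and gs = "(\<lambda>zs. zs ! Suc (Suc k)) # (\<lambda>zs. zs ! Suc (Suc (Suc k)) - 1) # map (\<lambda>i zs. zs ! i) [1..<Suc k]"])
        (use clocked_eval_total[OF assms(2)] in
          \<open>auto simp: o_def map_nth_take_upt simp del: upt_Suc intro: total_rec_nth total_rec_pred[simplified]\<close>)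
  qed auto
  then show "total_rec (Suc (Suc k)) (\<lambda>zs. c (zs ! Suc k) (take (Suc k) zs))"
  proof (rule total_rec_cong[THEN iffD1, rotated])
    fix zs :: "nat list" assume zs: "length zs = Suc (Suc k)"
    have "map ((!) zs) [1..<Suc k] = tl (take (Suc k) zs)"
      by (rule nth_equalityI) (use zs in \<open>auto simp: nth_tl simp del: upt_Suc\<close>)
    moreover have "hd (take (Suc k) zs) = zs ! 0" using zs by (cases zs) auto
    ultimately show "rec_nat (cf (zs ! Suc k) (map ((!) zs) [1..<Suc k]))
      (\<lambda>m y. if y = 0 then 0 else cg (zs ! Suc k) (m # (y - 1) # map ((!) zs) [1..<Suc k])) (zs ! 0)
      = c (zs ! Suc k) (take (Suc k) zs)" by (simp only: c_def)
  qed
next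
  have c_0: "c t (0 # ys) = cf t ys" for t ys by (simp add: c_def)
  have c_Suc: "c t (Suc n # ys) =
      (if c t (n # ys) = 0 then 0 else cg t (n # (c t (n # ys) - 1) # ys))" for t n ys
    by (simp add: c_def cong: if_cong)
  have mono: "c t' (m # ys) = c t (m # ys)"
    if "length ys = k" "c t (m # ys) \<noteq> 0" "t \<le> t'" for m t t' ys
    using that(2)
  proof (induction m)
    case 0
    then show ?case using clocked_eval_mono[OF f that(1) _ that(3)] by (simp add: c_0)
  next
    case (Suc n)
    from Suc.prems have nz: "c t (n # ys) \<noteq> 0" by (auto simp: c_Suc split: if_splits)
    with Suc.prems have "cg t (n # (c t (n # ys) - 1) # ys) \<noteq> 0" by (simp add: c_Suc)
    then have "cg t' (n # (c t (n # ys) - 1) # ys) = cg t (n # (c t (n # ys) - 1) # ys)"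
      using that by (intro clocked_eval_mono[OF g]) auto
    then show ?case using nz Suc.IH[OF nz] by (simp add: c_Suc)
  qed
  show "c t' xs = c t xs" if "length xs = Suc k" "c t xs \<noteq> 0" "t \<le> t'" for xs t t'
    using mono[of "tl xs" t "hd xs" t'] that by (cases xs) auto
  have "(eval (PrimRec f g) (n # ys) = Some y) = (\<exists>t. c t (n # ys) = Suc y)"
    if ys: "length ys = k" for n ys y
  proof (induction n arbitrary: y)
    case 0
    then show ?case using clocked_eval_Some[OF f ys] by (simp add: c_0)
  next
    case (Suc n)
    have ev_g: "eval g (n # z # ys) = Some y \<longleftrightarrow> (\<exists>t. cg t (n # z # ys) = Suc y)" for z
      by (rule clocked_eval_Some[OF g]) (simp add: ys)
    show ?case
    proof
      assume "eval (PrimRec f g) (Suc n # ys) = Some y"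
      then obtain z where z: "eval (PrimRec f g) (n # ys) = Some z" "eval g (n # z # ys) = Some y"
        by (auto split: option.splits)
      obtain t1 where t1: "c t1 (n # ys) = Suc z" using z(1) Suc by blast
      obtain t2 where t2: "cg t2 (n # z # ys) = Suc y" using z(2) ev_g by blast
      have "c (max t1 t2) (n # ys) = Suc z" using mono[OF ys, of t1 n "max t1 t2"] t1 by simp
      moreover have "cg (max t1 t2) (n # z # ys) = Suc y"
        using clocked_eval_mono[OF g, of "n # z # ys" t2 "max t1 t2"] ys t2 by simp
      ultimately have "c (max t1 t2) (Suc n # ys) = Suc y" by (simp add: c_Suc)
      then show "\<exists>t. c t (Suc n # ys) = Suc y" by blast
    next
      assume "\<exists>t. c t (Suc n # ys) = Suc y"
      then obtain t where t: "c t (Suc n # ys) = Suc y" ..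
      then obtain z where z: "c t (n # ys) = Suc z" by (cases "c t (n # ys)") (auto simp: c_Suc)
      have "cg t (n # z # ys) = Suc y" using t z by (simp add: c_Suc)
      then have "eval g (n # z # ys) = Some y" using ev_g by blast
      moreover have "eval (PrimRec f g) (n # ys) = Some z" using Suc z by blast
      ultimately show "eval (PrimRec f g) (Suc n # ys) = Some y" by simp
    qed
  qed
  then show "(eval (PrimRec f g) xs = Some y) = (\<exists>t. c t xs = Suc y)" if "length xs = Suc k" for xs y
    using that by (cases xs) auto
qed

text \<open>\<open>P t xs n\<close> says that stage \<open>t\<close> certifies \<open>n\<close> as
  the value: \<open>cf = 1\<close> is a found 0, \<open>1 < cf\<close> a found positive value. At
  most one \<open>n\<close> is certified at a stage, since of two the smaller would need
  \<open>cf\<close> to be both 1 and greater than 1. The disjunct \<open>t \<le> n\<close> makes the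
  search for the least number total.\<close>

lemma clocked_eval_Mu:
  assumes "clocked_eval (Suc k) f cf"
  defines "P \<equiv> \<lambda>t xs n. cf t (n # xs) = 1 \<and> (\<forall>m<n. 1 < cf t (m # xs))"
  defines "c \<equiv> \<lambda>t xs. if \<exists>n<t. P t xs n then Suc (LEAST n. t \<le> n \<or> P t xs n) else 0"
  shows "clocked_eval k (Mu f) c"
proof -
  have c: "c t xs = Suc n" if "n < t" "P t xs n" for t xs n
  proof -
    have "n \<le> m" if "t \<le> m \<or> P t xs m" for m
    proof (rule ccontr)
      assume "\<not> n \<le> m"
      then have "P t xs m" using that \<open>n < t\<close> by simp
      then show False using \<open>P t xs n\<close> \<open>\<not> n \<le> m\<close> by (auto simp: P_def not_le)
    qed
    then have "(LEAST n. t \<le> n \<or> P t xs n) = n"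
      using that by (intro Least_equality) simp_all
    then show ?thesis using that by (auto simp: c_def)
  qed
  have c_nz: "\<exists>n<t. P t xs n" if "c t xs \<noteq> 0" for t xs
    using that by (auto simp: c_def split: if_splits)
  show ?thesis
    unfolding clocked_eval_def
  proof (intro conjI allI impI)
    have cf: "total_rec j (\<lambda>zs. cf (zs ! k) (zs ! i # take k zs))" if "k < j" "i < j" for i j
      by (rule total_rec_clocked[where m = "Suc k" and c = cf and tf = "\<lambda>zs. zs ! k"
            and gs = "(\<lambda>zs. zs ! i) # map (\<lambda>i zs. zs ! i) [0..<k]"])
        (use clocked_eval_total[OF assms(1)] that in
          \<open>auto simp: o_def map_nth_upt0 intro!: total_rec_nth\<close>)
    have P: "decidable (Suc (Suc k)) (\<lambda>zs. P (zs ! k) (take k zs) (zs ! Suc k))"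
      unfolding P_def by (intro decidable_conj decidable_eq decidable_ball decidable_less
          total_rec_const total_rec_nth) (auto intro: cf)
    show "total_rec (Suc k) (\<lambda>zs. c (zs ! k) (take k zs))"
      unfolding c_def by (intro total_rec_if decidable_bex total_rec_Suc total_rec_Least total_rec_const
          decidable_disj decidable_le total_rec_nth) (use P in \<open>auto intro: total_rec_nth\<close>)
  next
    fix xs :: "nat list" and t t' assume xs: "length xs = k" and nz: "c t xs \<noteq> 0" and le: "t \<le> t'"
    obtain n where n: "n < t" "P t xs n" using c_nz[OF nz] by blast
    moreover have "P t' xs n"
      unfolding P_def
    proof (intro conjI allI impI)
      show "cf t' (n # xs) = 1"
        using clocked_eval_mono[OF assms(1), of "n # xs" t t'] n(2) le xs by (simp add: P_def)
      show "1 < cf t' (m # xs)" if "m < n" for m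
        using clocked_eval_mono[OF assms(1), of "m # xs" t t'] n(2) le xs that by (auto simp: P_def)
    qed
    ultimately show "c t' xs = c t xs" using c[of n t] c[of n t'] le by simp
  next
    fix xs :: "nat list" and y assume xs: "length xs = k"
    have ev: "eval f (n # xs) = Some z \<longleftrightarrow> (\<exists>t. cf t (n # xs) = Suc z)" for n z
      by (rule clocked_eval_Some[OF assms(1)]) (simp add: xs)
    have mono: "cf t' (n # xs) = cf t (n # xs)" if "cf t (n # xs) \<noteq> 0" "t \<le> t'" for n t t'
      using clocked_eval_mono[OF assms(1) _ that] xs by simp
    \<comment> \<open>\<open>Mu\<close> asks for definedness below some zero and then takes the
      least zero. Below the least zero, defined means defined and positive, which is what the clocks
      can show.\<close>
    have Mu: "eval (Mu f) xs = Some y \<longleftrightarrow>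
        eval f (y # xs) = Some 0 \<and> (\<forall>m<y. \<exists>z. eval f (m # xs) = Some (Suc z))" (is "_ \<longleftrightarrow> ?R")
    proof
      assume "eval (Mu f) xs = Some y"
      then obtain n where n: "eval f (n # xs) = Some 0" "\<forall>m<n. eval f (m # xs) \<noteq> None"
        and y: "y = (LEAST n. eval f (n # xs) = Some 0)" by (auto split: if_splits)
      have "eval f (y # xs) = Some 0" "y \<le> n" unfolding y using n(1) by (auto intro: LeastI Least_le)
      moreover have "\<exists>z. eval f (m # xs) = Some (Suc z)" if "m < y" for m
      proof -
        have "eval f (m # xs) \<noteq> Some 0" using that y not_less_Least by blast
        moreover have "eval f (m # xs) \<noteq> None" using n(2) that \<open>y \<le> n\<close> by auto
        ultimately show ?thesis by (metis not0_implies_Suc option.exhaust)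
      qed
      ultimately show ?R by simp
    next
      assume R: ?R
      then have "\<forall>m<y. eval f (m # xs) \<noteq> None" by fastforce
      moreover have "(LEAST n. eval f (n # xs) = Some 0) = y"
      proof (rule Least_equality)
        show "eval f (y # xs) = Some 0" using R ..
        show "y \<le> n" if "eval f (n # xs) = Some 0" for n
          using R that by (metis linorder_not_less nat.distinct(1) option.inject)
      qed
      moreover have "eval f (y # xs) = Some 0" using R ..
      ultimately show "eval (Mu f) xs = Some y" unfolding eval.simps by (metis (lifting))
    qed
    show "(eval (Mu f) xs = Some y) = (\<exists>t. c t xs = Suc y)"
    proof
      assume "eval (Mu f) xs = Some y"
      then have ev_0: "eval f (y # xs) = Some 0"
        and ev_Suc: "\<forall>m<y. \<exists>z. eval f (m # xs) = Some (Suc z)"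
        using Mu by blast+
      obtain t0 where t0: "cf t0 (y # xs) = 1" using ev_0 ev[of y 0] by auto
      have "\<exists>t. m < y \<longrightarrow> 1 < cf t (m # xs)" for m
        using ev_Suc ev[of m] by (metis One_nat_def Suc_less_eq zero_less_Suc)
      then obtain T where T: "\<And>m. m < y \<Longrightarrow> 1 < cf (T m) (m # xs)" by metis
      \<comment> \<open>\<open>Suc y\<close> enters the maximum because the clock inspects only
        candidates below the stage.\<close>
      define t where "t = Max (insert (Suc y) (insert t0 (T ` {..<y})))"
      have ge: "Suc y \<le> t" "t0 \<le> t" "\<And>m. m < y \<Longrightarrow> T m \<le> t" unfolding t_def by (intro Max_ge; auto)+
      have "cf t (y # xs) = 1" using mono[of t0 y t] t0 ge by simp
      moreover have "1 < cf t (m # xs)" if "m < y" for m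
        using mono[of "T m" m t] T[OF that] ge(3)[OF that] by simp
      ultimately have "P t xs y" by (simp add: P_def)
      then show "\<exists>t. c t xs = Suc y" using c[of y t] ge(1) by (intro exI[of _ t]) simp
    next
      assume "\<exists>t. c t xs = Suc y"
      then obtain t where eq: "c t xs = Suc y" ..
      then obtain n where n: "n < t" "P t xs n" using c_nz[of t xs] by auto
      then have "P t xs y" using c[OF n] eq by simp
      then have cf_y: "cf t (y # xs) = Suc 0" and lt: "\<And>m. m < y \<Longrightarrow> 1 < cf t (m # xs)"
        unfolding P_def by simp_all
      have "eval f (y # xs) = Some 0" unfolding ev using cf_y by blast
      moreover have "\<exists>z. eval f (m # xs) = Some (Suc z)" if "m < y" for m
      proof -
        have "cf t (m # xs) = Suc (Suc (cf t (m # xs) - 2))" using lt[OF that] by linarith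
        then show ?thesis unfolding ev by blast
      qed
      ultimately show "eval (Mu f) xs = Some y" using Mu by blast
    qed
  qed
qed

text \<open>Terms carry no arity and subterms may be run at other lengths, so the induction covers
  every \<open>k\<close> at once. Where the length makes \<open>Succ\<close>, \<open>Proj\<close> or
  \<open>PrimRec\<close> undefined, the clock is constantly 0.\<close>

lemma clocked_eval_exists: "\<exists>c. clocked_eval k r c"
proof (induction r arbitrary: k)
  case Zero
  have "clocked_eval k Zero (\<lambda>_ _. 1)"
    by (simp add: clocked_eval_def total_rec_const)
  then show ?case by blast
next
  case Succ
  show ?case
  proof (cases "k = 1")
    case True
    have "clocked_eval 1 Succ (\<lambda>_ xs. Suc (Suc (xs ! 0)))"
      by (auto simp: clocked_eval_def length_Suc_conv intro!: total_rec_intros)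
    then show ?thesis using True by blast
  next
    case False
    then have "clocked_eval k Succ (\<lambda>_ _. 0)"
      by (auto simp: clocked_eval_def total_rec_const split: list.splits)
    then show ?thesis by blast
  qed
next
  case (Proj i)
  show ?case
  proof (cases "i < k")
    case True
    then have "clocked_eval k (Proj i) (\<lambda>_ xs. Suc (xs ! i))"
      by (auto simp: clocked_eval_def intro!: total_rec_intros)
    then show ?thesis by blast
  next
    case False
    then have "clocked_eval k (Proj i) (\<lambda>_ _. 0)" by (simp add: clocked_eval_def total_rec_const)
    then show ?thesis by blast
  qed
next
  case (Comp f gs)
  from Comp.IH(1) obtain cf where "clocked_eval (length gs) f cf" by blast
  moreover obtain C where "\<And>g. g \<in> set gs \<Longrightarrow> clocked_eval k g (C g)"
    using bchoice[of "set gs" "\<lambda>g c. clocked_eval k g c"] Comp.IH(2) by blast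
  ultimately show ?case using clocked_eval_Comp by blast
next
  case (PrimRec f g)
  show ?case
  proof (cases k)
    case 0
    then have "clocked_eval k (PrimRec f g) (\<lambda>_ _. 0)"
      by (simp add: clocked_eval_def total_rec_const)
    then show ?thesis by blast
  next
    case (Suc k')
    then show ?thesis using PrimRec.IH clocked_eval_PrimRec by blast
  qed
next
  case (Mu f)
  then show ?case using clocked_eval_Mu by blast
qed

section \<open>Pairs and lists\<close>

lemma total_rec_prod_encode:
  assumes "total_rec k f" "total_rec k g"
  shows "total_rec k (\<lambda>xs. prod_encode (f xs, g xs))"
proof -
  have "total_rec 1 (\<lambda>xs. rec_nat 0 (\<lambda>n y. y + Suc n) (xs ! 0))"
    by (intro total_rec_rec_nat total_rec_intros) auto
  moreover have "rec_nat 0 (\<lambda>n y. y + Suc n) m = triangle m" for m by (induction m) auto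
  ultimately have triangle: "total_rec 1 (\<lambda>xs. triangle (xs ! 0))" by simp
  show ?thesis
    unfolding prod_encode_def prod.case
    by (intro total_rec_add total_rec_comp1[OF triangle] assms)
qed

text \<open>Decoding by search; a component never exceeds the code, so the other one is quantified
  boundedly and the condition stays decidable.\<close>

lemma total_rec_fst_prod_decode: "total_rec k f \<Longrightarrow> total_rec k (\<lambda>xs. fst (prod_decode (f xs)))"
proof (rule total_rec_comp1[of "\<lambda>z. fst (prod_decode z)"])
  have "total_rec 1 (\<lambda>xs. LEAST y. \<exists>w\<le>xs ! 0. prod_encode (y, w) = xs ! 0)"
  proof (rule total_rec_Least)
    show "decidable (Suc 1) (\<lambda>zs. \<exists>w\<le>take 1 zs ! 0. prod_encode (zs ! 1, w) = take 1 zs ! 0)"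
      by simp (intro decidable_intros total_rec_prod_encode total_rec_intros; simp add: total_rec_nth)+
    show "\<exists>y. \<exists>w\<le>xs ! 0. prod_encode (y, w) = xs ! 0" for xs
      by (metis le_prod_encode_2 prod_decode_inverse surj_pair)
  qed
  moreover have "(LEAST y. \<exists>w\<le>z. prod_encode (y, w) = z) = fst (prod_decode z)" for z
  proof (rule Least_equality)
    show "\<exists>w\<le>z. prod_encode (fst (prod_decode z), w) = z"
      by (metis le_prod_encode_2 prod.collapse prod_decode_inverse)
  qed (metis eq_refl fst_conv prod_encode_inverse)
  ultimately show "total_rec 1 (\<lambda>xs. fst (prod_decode (xs ! 0)))" by simp
qed

lemma total_rec_snd_prod_decode: "total_rec k f \<Longrightarrow> total_rec k (\<lambda>xs. snd (prod_decode (f xs)))"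
proof (rule total_rec_comp1[of "\<lambda>z. snd (prod_decode z)"])
  have "total_rec 1 (\<lambda>xs. LEAST w. prod_encode (fst (prod_decode (xs ! 0)), w) = xs ! 0)"
  proof (rule total_rec_Least)
    show "decidable (Suc 1) (\<lambda>zs. prod_encode (fst (prod_decode (take 1 zs ! 0)), zs ! 1) = take 1 zs ! 0)"
      by simp (intro decidable_eq total_rec_prod_encode total_rec_fst_prod_decode total_rec_nth; simp)
    show "\<exists>w. prod_encode (fst (prod_decode (xs ! 0)), w) = xs ! 0" for xs
      by (metis prod.collapse prod_decode_inverse)
  qed
  moreover have "(LEAST w. prod_encode (fst (prod_decode z), w) = z) = snd (prod_decode z)" for z
    by (rule Least_equality) (simp, metis eq_refl snd_conv prod_encode_inverse)
  ultimately show "total_rec 1 (\<lambda>xs. snd (prod_decode (xs ! 0)))" by simp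
qed

text \<open>A nonempty list is coded as \<open>Suc\<close> of the pair of its head and the code of
  its tail. The formula also fits the empty list, since 0 - 1 = 0 and 0 decodes to (0, 0); tails can
  therefore be iterated without a case distinction.\<close>

lemma list_encode_tl: "list_encode (tl (list_decode s)) = snd (prod_decode (s - 1))"
proof (cases s)
  case 0
  have "prod_decode 0 = (0, 0)" by (metis prod_encode_prod_decode_aux prod_decode_def
        prod_decode_aux.simps le0 diff_0_eq_0)
  then show ?thesis using 0 by simp
qed (simp split: prod.split)

lemma total_rec_drop:
  assumes "total_rec k m" "total_rec k s"
  shows "total_rec k (\<lambda>xs. list_encode (drop (m xs) (list_decode (s xs))))"
proof -
  have "total_rec k (\<lambda>xs. rec_nat (s xs) (\<lambda>_ y. snd (prod_decode (y - 1))) (m xs))"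
    by (intro total_rec_rec_nat total_rec_snd_prod_decode total_rec_pred total_rec_nth assms) auto
  moreover have "rec_nat c (\<lambda>_ y. snd (prod_decode (y - 1))) n = list_encode (drop n (list_decode c))" for c n
  proof (induction n)
    case (Suc n)
    then show ?case
      using list_encode_tl[of "list_encode (drop n (list_decode c))"] by (simp add: drop_Suc tl_drop)
  qed simp
  ultimately show ?thesis by simp
qed

lemma total_rec_length:
  assumes "total_rec k s"
  shows "total_rec k (\<lambda>xs. length (list_decode (s xs)))"
proof (rule total_rec_comp1[of "\<lambda>c. length (list_decode c)", OF _ assms])
  have "total_rec 1 (\<lambda>xs. LEAST n. list_encode (drop n (list_decode (xs ! 0))) = 0)"
  proof (rule total_rec_Least)
    show "decidable (Suc 1) (\<lambda>zs. list_encode (drop (zs ! 1) (list_decode (take 1 zs ! 0))) = 0)"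
      by simp (intro decidable_eq total_rec_drop total_rec_nth total_rec_const; simp)
    show "\<exists>n. list_encode (drop n (list_decode (xs ! 0))) = 0" for xs
      by (rule exI[of _ "length (list_decode (xs ! 0))"]) simp
  qed
  moreover have "(LEAST n. list_encode (drop n l) = 0) = length l" for l
  proof (rule Least_equality)
    show "length l \<le> n" if "list_encode (drop n l) = 0" for n
      using that by (metis drop_eq_Nil list_encode.simps(1) list_encode_eq)
  qed simp
  ultimately show "total_rec 1 (\<lambda>xs. length (list_decode (xs ! 0)))" by simp
qed

text \<open>A recursive counterpart of \<open>!\<close> on codes: the head of what remains after
  \<open>n\<close> entries, with value 0 past the end.\<close>

definition nth_code :: "nat \<Rightarrow> nat \<Rightarrow> nat" where
  "nth_code s n = fst (prod_decode (list_encode (drop n (list_decode s)) - 1))"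

lemma nth_code: "n < length (list_decode s) \<Longrightarrow> nth_code s n = list_decode s ! n"
  by (simp add: nth_code_def flip: Cons_nth_drop_Suc)

lemma total_rec_nth_code:
  "total_rec k s \<Longrightarrow> total_rec k m \<Longrightarrow> total_rec k (\<lambda>xs. nth_code (s xs) (m xs))"
  unfolding nth_code_def by (intro total_rec_fst_prod_decode total_rec_pred total_rec_drop)

text \<open>Iterating tails does not produce prefixes, so the code is found by search: it is
  determined by its length and its entries, both already recursive.\<close>

lemma total_rec_list_encode_take:
  assumes "total_rec k m" "total_rec k s"
  shows "total_rec k (\<lambda>xs. list_encode (take (m xs) (list_decode (s xs))))"
proof (rule total_rec_comp2[of "\<lambda>m s. list_encode (take m (list_decode s))", OF _ assms])
  define P where "P m s c \<longleftrightarrow> length (list_decode c) =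
      (if m \<le> length (list_decode s) then m else length (list_decode s)) \<and>
      (\<forall>n<length (list_decode c). nth_code c n = nth_code s n)" for m s c
  have P: "P m s c \<longleftrightarrow> c = list_encode (take m (list_decode s))" for m s c
  proof
    assume P: "P m s c"
    have "list_decode c = take m (list_decode s)"
      by (rule nth_equalityI)
        (use P nth_code[of _ c] nth_code[of _ s] in \<open>auto simp: P_def split: if_splits\<close>)
    then show "c = list_encode (take m (list_decode s))" by (metis list_decode_inverse)
  qed (auto simp: P_def nth_code)
  have "total_rec 2 (\<lambda>xs. LEAST c. P (xs ! 0) (xs ! 1) c)"
  proof (rule total_rec_Least)
    show "decidable (Suc 2) (\<lambda>zs. P (take 2 zs ! 0) (take 2 zs ! 1) (zs ! 2))"
      unfolding P_def
      by simp (intro decidable_intros total_rec_nth_code total_rec_length total_rec_if total_rec_nth; simp add: total_rec_nth)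
  qed (simp add: P)
  moreover have "(LEAST c. P m s c) = list_encode (take m (list_decode s))" for m s
    unfolding P by (rule Least_equality) auto
  ultimately show "total_rec 2 (\<lambda>xs. list_encode (take (xs ! 0) (list_decode (xs ! 1))))"
    by simp
qed

text \<open>Serves to pass from a position in a coded list to the entry there, under a bounded
  quantifier over positions.\<close>

lemma decidable_subst_last:
  assumes "decidable (Suc k) (\<lambda>zs. P (take k zs) (zs ! k))" "total_rec j f" "k \<le> j"
  shows "decidable j (\<lambda>xs. P (take k xs) (f xs))"
proof -
  have "decidable (length (map (\<lambda>i xs. xs ! i) [0..<k] @ [f])) (\<lambda>zs. P (take k zs) (zs ! k))"
    using assms(1) by simp
  moreover have "total_rec j h" if "h \<in> set (map (\<lambda>i xs. xs ! i) [0..<k] @ [f])" for h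
    using that assms(2,3) by (auto simp: total_rec_nth)
  ultimately have "decidable j (\<lambda>xs. (\<lambda>zs. P (take k zs) (zs ! k))
      (map (\<lambda>h. h xs) (map (\<lambda>i xs. xs ! i) [0..<k] @ [f])))"
    by (rule decidable_comp)
  then have "decidable j (\<lambda>xs. P (map ((!) xs) [0..<k]) (f xs))"
    by (simp add: o_def nth_append)
  then show ?thesis
    by (rule decidable_cong[THEN iffD1, rotated]) (use assms(3) in \<open>simp add: map_nth_upt0\<close>)
qed

lemma decidable_ball_list_decode:
  assumes "total_rec k s" "decidable (Suc k) (\<lambda>zs. P (take k zs) (zs ! k))"
  shows "decidable k (\<lambda>xs. \<forall>x\<in>set (list_decode (s xs)). P xs x)"
proof -
  have "total_rec (Suc k) (\<lambda>zs. s (take k zs))" by (rule total_rec_take[OF assms(1)]) simp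
  then have "decidable k (\<lambda>xs. \<forall>n<length (list_decode (s xs)). P xs (nth_code (s xs) n))"
    by (intro decidable_ball total_rec_length assms(1) decidable_subst_last[OF assms(2)]
        total_rec_nth_code total_rec_nth) simp_all
  moreover have "(\<forall>n<length (list_decode c). Q (nth_code c n)) \<longleftrightarrow> (\<forall>x\<in>set (list_decode c). Q x)" for c Q
    by (metis in_set_conv_nth nth_code)
  ultimately show ?thesis by simp
qed

lemma decidable_set_subset:
  assumes "total_rec k s" "total_rec k u"
  shows "decidable k (\<lambda>xs. set (list_decode (s xs)) \<subseteq> set (list_decode (u xs)))"
proof -
  have "total_rec (Suc k) (\<lambda>zs. u (take k zs))" by (rule total_rec_take[OF assms(2)]) simp
  then have "decidable k (\<lambda>xs. \<forall>x\<in>set (list_decode (s xs)). \<not> (\<forall>y\<in>set (list_decode (u xs)). x \<noteq> y))"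
    by (intro decidable_ball_list_decode decidable_not decidable_eq assms total_rec_nth)
      (auto simp: total_rec_nth)
  then show ?thesis by (simp add: subset_iff Ball_def)
qed

lemma decidable_prefix:
  assumes "total_rec k s" "total_rec k u"
  shows "decidable k (\<lambda>xs. prefix (list_decode (s xs)) (list_decode (u xs)))"
proof -
  have "prefix (list_decode c) (list_decode d) \<longleftrightarrow>
      list_encode (take (length (list_decode c)) (list_decode d)) = c" for c d
    by (metis append_eq_conv_conj list_decode_inverse list_encode_inverse prefix_def take_is_prefix)
  then show ?thesis
    by simp (intro decidable_eq total_rec_list_encode_take total_rec_length assms)
qed

section \<open>Totalized machines and stabilizing sequences\<close>

text \<open>
  \<open>H z t\<close> says that \<open>z\<close> has entered the graph of a machine by stage \<open>t\<close>. If no prefix of \<open>s\<close> has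
  received a value by stage \<open>length s\<close>, the result is the default \<open>Suc (length s)\<close>.
\<close>

definition clocked_hyp :: "(nat \<Rightarrow> nat \<Rightarrow> bool) \<Rightarrow> nat list \<Rightarrow> nat" where
  "clocked_hyp H s = (LEAST y. length s < y \<or>
     (\<exists>m\<le>length s. H (prod_encode (list_encode (take m s), y)) (length s) \<and>
       (\<forall>m'\<le>length s. m < m' \<longrightarrow>
         (\<forall>v\<le>length s. \<not> H (prod_encode (list_encode (take m' s), v)) (length s)))))"

lemma total_rec_clocked_hyp:
  assumes T: "decidable 3 (\<lambda>xs. T (xs ! 0) (xs ! 1) (xs ! 2))"
    and "total_rec k a" "total_rec k s"
  shows "total_rec k (\<lambda>xs. clocked_hyp (T (a xs)) (list_decode (s xs)))"
proof (rule total_rec_comp2[of "\<lambda>a s. clocked_hyp (T a) (list_decode s)", OF _ assms(2,3)])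
  show "total_rec 2 (\<lambda>xs. clocked_hyp (T (xs ! 0)) (list_decode (xs ! 1)))"
    unfolding clocked_hyp_def
    apply (intro total_rec_Least decidable_disj decidable_less decidable_bex_le decidable_conj
        decidable_ball_le decidable_imp decidable_not decidable_comp3[OF T] total_rec_length
        total_rec_prod_encode total_rec_list_encode_take total_rec_nth)
    apply (simp_all add: total_rec_nth total_rec_length)
    apply (rule exI, rule disjI1, rule lessI)
    done
qed

text \<open>A locking sequence stripped of the correctness of its hypothesis: a learner can notice a
  change of mind, but not an incorrect hypothesis.\<close>

definition stabilizes :: "(nat list \<Rightarrow> nat) \<Rightarrow> nat set \<Rightarrow> nat list \<Rightarrow> bool" where
  "stabilizes N A s \<longleftrightarrow> set s \<subseteq> A \<and> (\<forall>u. set u \<subseteq> A \<longrightarrow> prefix s u \<longrightarrow> N u = N s)"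

text \<open>The disjunct \<open>length s \<le> c\<close> bounds the search; it becomes irrelevant on long inputs.\<close>

definition stab_learner :: "(nat list \<Rightarrow> nat) \<Rightarrow> nat list \<Rightarrow> nat" where
  "stab_learner N s = N (list_decode (LEAST c. length s \<le> c \<or>
     set (list_decode c) \<subseteq> set s \<and>
     (\<forall>d\<le>length s. set (list_decode d) \<subseteq> set s \<longrightarrow> prefix (list_decode c) (list_decode d) \<longrightarrow>
        N (list_decode d) = N (list_decode c))))"

lemma total_rec_stab_learner:
  assumes "total_rec 1 (\<lambda>xs. N (list_decode (xs ! 0)))"
  shows "total_rec 1 (\<lambda>xs. stab_learner N (list_decode (xs ! 0)))"
  unfolding stab_learner_def
  apply (intro total_rec_comp1[of "\<lambda>c. N (list_decode c)", OF assms] total_rec_Least decidable_disj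
      decidable_le decidable_conj decidable_ball_le decidable_imp decidable_eq decidable_set_subset
      decidable_prefix total_rec_length total_rec_nth)
  apply (simp_all add: total_rec_nth total_rec_length)
  apply (rule exI, rule disjI1, rule order_refl)
  done

section \<open>Convergence of totalized machines and of the learner\<close>

lemma initial_segment_simps [simp]:
  "length (initial_segment f i) = i"
  "j < i \<Longrightarrow> initial_segment f i ! j = f j"
  "m \<le> i \<Longrightarrow> take m (initial_segment f i) = initial_segment f m"
  "set (initial_segment f i) = f ` {..<i}"
  by (auto simp: initial_segment_def take_map min_def lessThan_atLeast0)

lemma eventually_subset_initial_segment:
  assumes "finite B" "B \<subseteq> range f"
  shows "\<forall>\<^sub>F i in sequentially. B \<subseteq> set (initial_segment f i)"
proof -
  obtain C where "finite C" "B = f ` C" using assms finite_subset_image by metis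
  moreover have "\<forall>\<^sub>F i in sequentially. \<forall>c\<in>C. c < i"
    using \<open>finite C\<close> by (intro eventually_ball_finite) (auto intro: eventually_gt_at_top)
  ultimately show ?thesis by (auto elim!: eventually_mono)
qed

text \<open>A late prefix has the limit value, which becomes visible at a finite stage. From then on
  the longest prefix with a visible value lies past the point of convergence, so its value is the
  limit, even if \<open>M\<close> is undefined on earlier segments.\<close>

lemma clocked_hyp_converges:
  assumes H: "\<And>s v. M s = Some v \<longleftrightarrow> (\<exists>t. H (prod_encode (list_encode s, v)) t)"
    and mono: "\<And>z t t'. H z t \<Longrightarrow> t \<le> t' \<Longrightarrow> H z t'"
    and M: "\<forall>\<^sub>F i in sequentially. M (initial_segment f i) = Some n"
  shows "\<forall>\<^sub>F i in sequentially. clocked_hyp H (initial_segment f i) = n"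
proof -
  obtain i0 where i0: "\<And>i. i0 \<le> i \<Longrightarrow> M (initial_segment f i) = Some n"
    using M by (auto simp: eventually_sequentially)
  then obtain t0 where t0: "H (prod_encode (list_encode (initial_segment f i0), n)) t0"
    using H by blast
  \<comment> \<open>The lower bounds put the prefix of length \<open>i0\<close> among those
    inspected, its value within the bound on values and its convergence within the stage.\<close>
  have "clocked_hyp H (initial_segment f i) = n" if i: "max i0 (max n t0) \<le> i" for i
  proof -
    let ?Q = "\<lambda>m. m \<le> i \<and> (\<exists>v\<le>i. H (prod_encode (list_encode (initial_segment f m), v)) i)"
    have Q0: "?Q i0" using i mono[OF t0, of i] by auto
    have v: "v = n" if "H (prod_encode (list_encode (initial_segment f m), v)) i" "i0 \<le> m" for m v
      using that i0[of m] H by (metis option.inject)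
    define m where "m = (GREATEST m. ?Q m)"
    have Qm: "?Q m" unfolding m_def by (rule GreatestI_nat[where P = ?Q and b = i, OF Q0]) simp
    have le_m: "m' \<le> m" if "?Q m'" for m'
      unfolding m_def by (rule Greatest_le_nat[where P = ?Q and b = i, OF that]) simp
    have "i0 \<le> m" using le_m[OF Q0] .
    show ?thesis
      unfolding clocked_hyp_def
    proof (rule Least_equality)
      have "H (prod_encode (list_encode (initial_segment f m), n)) i"
        using Qm v \<open>i0 \<le> m\<close> by blast
      then show "length (initial_segment f i) < n \<or>
        (\<exists>m\<le>length (initial_segment f i).
          H (prod_encode (list_encode (take m (initial_segment f i)), n)) (length (initial_segment f i)) \<and>
          (\<forall>m'\<le>length (initial_segment f i). m < m' \<longrightarrow> (\<forall>v\<le>length (initial_segment f i).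
            \<not> H (prod_encode (list_encode (take m' (initial_segment f i)), v)) (length (initial_segment f i)))))"
        using Qm le_m by (intro disjI2 exI[of _ m]) (auto simp: not_le[symmetric])
    next
      fix y
      assume y: "length (initial_segment f i) < y \<or>
        (\<exists>m\<le>length (initial_segment f i).
          H (prod_encode (list_encode (take m (initial_segment f i)), y)) (length (initial_segment f i)) \<and>
          (\<forall>m'\<le>length (initial_segment f i). m < m' \<longrightarrow> (\<forall>v\<le>length (initial_segment f i).
            \<not> H (prod_encode (list_encode (take m' (initial_segment f i)), v)) (length (initial_segment f i)))))"
      show "n \<le> y"
      proof (cases "i < y")
        case False
        then obtain m' where m': "m' \<le> i" "H (prod_encode (list_encode (initial_segment f m'), y)) i"
          "\<And>m''. m'' \<le> i \<Longrightarrow> m' < m'' \<Longrightarrow> \<not> ?Q m''"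
          using y by auto
        \<comment> \<open>A shorter \<open>m'\<close> would be overruled by the prefix of length
          \<open>i0\<close>, whose value is visible.\<close>
        then have "i0 \<le> m'" using Q0 by (metis not_le)
        then show ?thesis using v m'(2) by blast
      qed (use i in simp)
    qed
  qed
  then show ?thesis unfolding eventually_sequentially by blast
qed

lemma ex_enumeration: "x \<in> A \<Longrightarrow> \<exists>g :: nat \<Rightarrow> nat. range g = A"
  by (rule exI[of _ "\<lambda>n. if n \<in> A then n else x"]) auto

text \<open>
  Without a stabilizing sequence, one could extend forever while alternately adding the next
  element of \<open>A\<close> and forcing a change of hypothesis; the limit is an enumeration
  of \<open>A\<close> on which \<open>N\<close> diverges.
\<close>

lemma ex_stabilizes:
  assumes conv: "\<And>f. range f = A \<Longrightarrow> \<exists>n. \<forall>\<^sub>F i in sequentially. N (initial_segment f i) = n"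
  shows "\<exists>s. stabilizes N A s"
proof (rule ccontr)
  assume none: "\<nexists>s. stabilizes N A s"
  have "A \<noteq> {}"
  proof
    assume "A = {}"
    then have "stabilizes N A []" by (simp add: stabilizes_def)
    with none show False by blast
  qed
  then obtain g :: "nat \<Rightarrow> nat" where g: "range g = A" using ex_enumeration by blast
  have "\<exists>u. set s \<subseteq> A \<longrightarrow> set u \<subseteq> A \<and> prefix s u \<and> N u \<noteq> N s" for s
    using none by (auto simp: stabilizes_def)
  then obtain ext where ext: "\<And>s. set s \<subseteq> A \<Longrightarrow> set (ext s) \<subseteq> A \<and> prefix s (ext s) \<and> N (ext s) \<noteq> N s"
    by metis
  \<comment> \<open>Appending \<open>g n\<close> before forcing a change makes the limit list all of
    \<open>A\<close> and gives \<open>S n\<close> length at least \<open>n\<close>.\<close>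
  define S where "S = rec_nat [] (\<lambda>n s. ext (s @ [g n]))"
  have S_Suc: "S (Suc n) = ext (S n @ [g n])" for n by (simp add: S_def)
  have S_A: "set (S n) \<subseteq> A" for n
  proof (induction n)
    case (Suc n)
    then have "set (S n @ [g n]) \<subseteq> A" using g by auto
    then show ?case using ext by (simp add: S_Suc)
  qed (simp add: S_def)
  then have SgA: "set (S n @ [g n]) \<subseteq> A" for n using g by auto
  have pre: "prefix (S n @ [g n]) (S (Suc n))" for n using ext[OF SgA] by (simp add: S_Suc)
  have len: "n \<le> length (S n)" for n
  proof (induction n)
    case (Suc n)
    then show ?case using prefix_length_le[OF pre[of n]] by simp
  qed simp
  have pre_le: "prefix (S m) (S n)" if "m \<le> n" for m n
    using that
  proof (induction rule: dec_induct)
    case (step n)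
    then show ?case using pre[of n] by (meson append_prefixD prefix_order.trans)
  qed simp
  define f where "f k = S (Suc k) ! k" for k
  have f: "f k = S n ! k" if "k < length (S n)" for k n
  proof -
    have "k < length (S (Suc k))" using len[of "Suc k"] by simp
    then show ?thesis
      using pre_le[of n "Suc k"] pre_le[of "Suc k" n] that unfolding f_def
      by (metis nle_le prefix_def nth_append)
  qed
  have init: "initial_segment f (length s) = s" if "prefix s (S n)" for s n
  proof (rule nth_equalityI)
    fix k assume "k < length (initial_segment f (length s))"
    then have "k < length s" by simp
    then show "initial_segment f (length s) ! k = s ! k"
      using f[of k n] that prefix_length_le[OF that] by (auto simp: prefix_def nth_append)
  qed simp
  have "range f = A"
  proof
    show "range f \<subseteq> A"
    proof clarify
      fix k
      have "k < length (S (Suc k))" using len[of "Suc k"] by simp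
      then show "f k \<in> A" using S_A[of "Suc k"] unfolding f_def by (meson nth_mem subsetD)
    qed
    show "A \<subseteq> range f"
    proof
      fix x assume "x \<in> A"
      then obtain n where "x = g n" using g by blast
      then have "x \<in> set (S (Suc n))" using set_mono_prefix[OF pre[of n]] by auto
      then show "x \<in> range f" using f by (metis in_set_conv_nth rangeI)
    qed
  qed
  then obtain n K where K: "\<And>i. K \<le> i \<Longrightarrow> N (initial_segment f i) = n"
    using conv[of f] by (auto simp: eventually_sequentially)
  \<comment> \<open>\<open>S K @ [g K]\<close> and \<open>S (Suc K)\<close> are both initial
    segments of \<open>f\<close> of length at least \<open>K\<close>, yet \<open>ext\<close> was
    chosen to change the value between them.\<close>
  have "K \<le> length (S K @ [g K])" using len[of K] by simp
  from K[OF this] have "N (S K @ [g K]) = n" by (simp only: init[OF pre])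
  moreover have "N (S (Suc K)) = n"
    using K[of "length (S (Suc K))"] len[of "Suc K"] init[of "S (Suc K)" "Suc K"] by simp
  ultimately show False using ext[OF SgA[of K]] by (simp add: S_Suc)
qed

text \<open>Take an enumeration of \<open>A\<close> that begins with \<open>s\<close>: past
  \<open>s\<close> the hypothesis never leaves \<open>N s\<close>, so \<open>N s\<close> is the
  limit and inherits its correctness. The element \<open>x\<close> provides such an
  enumeration.\<close>

lemma stabilizes_correct:
  assumes learn: "\<And>f. range f = A \<Longrightarrow>
      \<exists>n. (\<forall>\<^sub>F i in sequentially. N (initial_segment f i) = n) \<and> eq_star (W n) A"
    and s: "stabilizes N A s" and "x \<in> A"
  shows "eq_star (W (N s)) A"
proof -
  obtain g :: "nat \<Rightarrow> nat" where g: "range g = A" using ex_enumeration \<open>x \<in> A\<close> by blast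
  define f where "f k = (if k < length s then s ! k else g (k - length s))" for k
  have sA: "set s \<subseteq> A" using s by (simp add: stabilizes_def)
  have fA: "range f = A"
  proof
    show "range f \<subseteq> A" using g sA by (auto simp: f_def)
    show "A \<subseteq> range f"
    proof
      fix x assume "x \<in> A"
      then obtain n where "x = g n" using g by blast
      then have "x = f (n + length s)" by (simp add: f_def)
      then show "x \<in> range f" by blast
    qed
  qed
  have N: "N (initial_segment f i) = N s" if "length s \<le> i" for i
  proof -
    have "take (length s) (initial_segment f i) = s"
      by (rule nth_equalityI) (use that in \<open>auto simp: f_def\<close>)
    then have "prefix s (initial_segment f i)" by (metis take_is_prefix)
    moreover have "set (initial_segment f i) \<subseteq> A" using fA by auto
    ultimately show ?thesis using s unfolding stabilizes_def by blast
  qed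
  obtain n where n: "\<forall>\<^sub>F i in sequentially. N (initial_segment f i) = n" "eq_star (W n) A"
    using learn[OF fA] by blast
  then obtain K where "\<forall>i\<ge>K. N (initial_segment f i) = n"
    unfolding eventually_sequentially by blast
  then have "n = N s" using N[of "max K (length s)"] by simp
  then show ?thesis using n(2) by simp
qed

text \<open>Each of the finitely many codes below the least stabilizing one, \<open>c0\<close>,
  eventually drops out: an entry outside \<open>A\<close> is never seen, and otherwise an extension
  with another value is found once its elements have appeared and its code is within the length.
  \<open>c0\<close> itself is never refuted.\<close>

lemma stab_learner_converges:
  assumes A: "range f = A" and ex: "\<exists>s. stabilizes N A s"
  shows "\<exists>s. stabilizes N A s \<and> (\<forall>\<^sub>F i in sequentially. stab_learner N (initial_segment f i) = N s)"
proof -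
  define c0 where "c0 = (LEAST c. stabilizes N A (list_decode c))"
  have "\<exists>c. stabilizes N A (list_decode c)" using ex by (metis list_encode_inverse)
  then have c0: "stabilizes N A (list_decode c0)" unfolding c0_def by (rule LeastI_ex)
  define Q where "Q s c \<longleftrightarrow> set (list_decode c) \<subseteq> set s \<and>
     (\<forall>d\<le>length s. set (list_decode d) \<subseteq> set s \<longrightarrow> prefix (list_decode c) (list_decode d) \<longrightarrow>
        N (list_decode d) = N (list_decode c))" for s c
  have "\<forall>\<^sub>F i in sequentially. \<not> Q (initial_segment f i) c" if "c < c0" for c
  proof (cases "set (list_decode c) \<subseteq> A")
    case False
    then have "\<not> Q (initial_segment f i) c" for i using A unfolding Q_def by auto
    then show ?thesis by simp
  next
    case True
    have "\<not> stabilizes N A (list_decode c)" using that not_less_Least unfolding c0_def by blast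
    then obtain u where u: "set u \<subseteq> A" "prefix (list_decode c) u" "N u \<noteq> N (list_decode c)"
      using True by (auto simp: stabilizes_def)
    have "\<forall>\<^sub>F i in sequentially. set u \<subseteq> set (initial_segment f i)"
      using u(1) A by (intro eventually_subset_initial_segment) auto
    moreover have "\<forall>\<^sub>F i in sequentially. list_encode u \<le> i" by (rule eventually_ge_at_top)
    ultimately show ?thesis
    proof eventually_elim
      case (elim i)
      then show ?case unfolding Q_def
        by (metis u(2,3) initial_segment_simps(1) list_encode_inverse)
    qed
  qed
  then have "\<forall>\<^sub>F i in sequentially. \<forall>c\<in>{..<c0}. \<not> Q (initial_segment f i) c"
    by (intro eventually_ball_finite) auto
  moreover have "\<forall>\<^sub>F i in sequentially. set (list_decode c0) \<subseteq> set (initial_segment f i)"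
    using c0 A by (intro eventually_subset_initial_segment) (auto simp: stabilizes_def)
  \<comment> \<open>From here on the escape clause \<open>length s \<le> c\<close> admits nothing
    below \<open>c0\<close>.\<close>
  moreover have "\<forall>\<^sub>F i in sequentially. c0 < i" by (rule eventually_gt_at_top)
  ultimately have "\<forall>\<^sub>F i in sequentially. stab_learner N (initial_segment f i) = N (list_decode c0)"
  proof eventually_elim
    case (elim i)
    have "set (initial_segment f i) \<subseteq> A" using A by auto
    then have "Q (initial_segment f i) c0"
      unfolding Q_def using elim(2) c0 by (meson order_trans stabilizes_def)
    then have "(LEAST c. length (initial_segment f i) \<le> c \<or> Q (initial_segment f i) c) = c0"
      by (intro Least_equality) (use elim in \<open>auto simp: not_le[symmetric]\<close>)
    then show ?case unfolding stab_learner_def Q_def by simp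
  qed
  then show ?thesis using c0 by blast
qed

section \<open>Closure properties of the arithmetical hierarchy\<close>

text \<open>With \<open>b = True\<close> these are the \<open>k\<close>-ary \<open>\<Sigma>\<^sub>n\<close> predicates, with \<open>b = False\<close> the \<open>\<Pi>\<^sub>n\<close> ones.\<close>

definition arith :: "bool \<Rightarrow> nat \<Rightarrow> nat \<Rightarrow> (nat list \<Rightarrow> bool) \<Rightarrow> bool" where
  "arith b n k P \<longleftrightarrow>
     (\<exists>R. decidable (k + n) R \<and> (\<forall>xs. length xs = k \<longrightarrow> (P xs \<longleftrightarrow> alternation b n R xs)))"

lemma arith_cong:
  "(\<And>xs. length xs = k \<Longrightarrow> P xs \<longleftrightarrow> Q xs) \<Longrightarrow> arith b n k P \<longleftrightarrow> arith b n k Q"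
  by (simp add: arith_def)

lemma arith_0: "arith b 0 k P \<longleftrightarrow> decidable k P"
  unfolding arith_def by (auto intro: decidable_cong[THEN iffD1, rotated])

text \<open>Trades the outermost quantifier for one more argument at the end, so that inductions on
  the level need not touch the decidable matrix.\<close>

lemma arith_Suc:
  "arith b (Suc n) k P \<longleftrightarrow> (\<exists>Q. arith (\<not> b) n (Suc k) Q \<and>
     (\<forall>xs. length xs = k \<longrightarrow> (P xs \<longleftrightarrow> (if b then \<exists>y. Q (xs @ [y]) else \<forall>y. Q (xs @ [y])))))"
proof
  assume "arith b (Suc n) k P"
  then obtain R where R: "decidable (k + Suc n) R"
    "\<And>xs. length xs = k \<Longrightarrow> P xs \<longleftrightarrow> alternation b (Suc n) R xs" unfolding arith_def by blast
  have "arith (\<not> b) n (Suc k) (alternation (\<not> b) n R)" unfolding arith_def using R(1) by auto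
  then show "\<exists>Q. arith (\<not> b) n (Suc k) Q \<and>
     (\<forall>xs. length xs = k \<longrightarrow> (P xs \<longleftrightarrow> (if b then \<exists>y. Q (xs @ [y]) else \<forall>y. Q (xs @ [y]))))"
    by (rule_tac exI[of _ "alternation (\<not> b) n R"]) (cases b; simp add: R(2))
next
  assume "\<exists>Q. arith (\<not> b) n (Suc k) Q \<and>
     (\<forall>xs. length xs = k \<longrightarrow> (P xs \<longleftrightarrow> (if b then \<exists>y. Q (xs @ [y]) else \<forall>y. Q (xs @ [y]))))"
  then obtain Q R where PQ: "\<And>xs. length xs = k \<Longrightarrow>
      P xs \<longleftrightarrow> (if b then \<exists>y. Q (xs @ [y]) else \<forall>y. Q (xs @ [y]))"
    and R: "decidable (Suc k + n) R"
    "\<And>xs. length xs = Suc k \<Longrightarrow> Q xs \<longleftrightarrow> alternation (\<not> b) n R xs"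
    unfolding arith_def by blast
  show "arith b (Suc n) k P"
    unfolding arith_def by (rule exI[of _ R]) (use R PQ in \<open>cases b; simp\<close>)
qed

lemma arith_not: "arith (\<not> b) n k P \<Longrightarrow> arith b n k (\<lambda>xs. \<not> P xs)"
proof -
  have "alternation b n (\<lambda>xs. \<not> R xs) xs \<longleftrightarrow> \<not> alternation (\<not> b) n R xs" for R xs
    by (induction n arbitrary: b xs) (auto, (case_tac b; simp)+)
  then show "arith (\<not> b) n k P \<Longrightarrow> arith b n k (\<lambda>xs. \<not> P xs)"
    unfolding arith_def using decidable_not by fastforce
qed

lemma arith_comp:
  assumes "arith b n (length gs) P" "\<And>g. g \<in> set gs \<Longrightarrow> total_rec k g"
  shows "arith b n k (\<lambda>xs. P (map (\<lambda>g. g xs) gs))"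
  using assms
proof (induction n arbitrary: b k gs P)
  case 0
  then show ?case by (simp add: arith_0 decidable_comp)
next
  case (Suc n)
  obtain Q where Q: "arith (\<not> b) n (Suc (length gs)) Q"
    "\<And>xs. length xs = length gs \<Longrightarrow> P xs \<longleftrightarrow> (if b then \<exists>y. Q (xs @ [y]) else \<forall>y. Q (xs @ [y]))"
    using Suc.prems(1) unfolding arith_Suc by blast
  \<comment> \<open>The given functions ignore the new last argument, which is passed through
    unchanged.\<close>
  define hs where "hs = map (\<lambda>g zs. g (take k zs)) gs @ [\<lambda>zs. zs ! k]"
  have "total_rec (Suc k) h" if "h \<in> set hs" for h
    using that Suc.prems(2) by (auto simp: hs_def total_rec_nth intro: total_rec_take)
  moreover have "arith (\<not> b) n (length hs) Q" using Q(1) by (simp add: hs_def)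
  ultimately have "arith (\<not> b) n (Suc k) (\<lambda>zs. Q (map (\<lambda>h. h zs) hs))" by (intro Suc.IH)
  moreover have "map (\<lambda>h. h (xs @ [y])) hs = map (\<lambda>g. g xs) gs @ [y]" if "length xs = k" for xs y
    using that by (simp add: hs_def nth_append)
  ultimately show ?case
    unfolding arith_Suc using Q(2)
    by (intro exI[of _ "\<lambda>zs. Q (map (\<lambda>h. h zs) hs)"]) simp
qed

lemma arith_comp2:
  assumes "arith b n 2 (\<lambda>xs. P (xs ! 0) (xs ! 1))" "total_rec k f" "total_rec k g"
  shows "arith b n k (\<lambda>xs. P (f xs) (g xs))"
  using arith_comp[of b n "[f, g]" "\<lambda>xs. P (xs ! 0) (xs ! 1)" k] assms
  by (auto simp: numeral_2_eq_2)

lemma arith_comp3: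
  assumes "arith b n 3 (\<lambda>xs. P (xs ! 0) (xs ! 1) (xs ! 2))"
    and "total_rec k f" "total_rec k g" "total_rec k h"
  shows "arith b n k (\<lambda>xs. P (f xs) (g xs) (h xs))"
  using arith_comp[of b n "[f, g, h]" "\<lambda>xs. P (xs ! 0) (xs ! 1) (xs ! 2)" k] assms
  by (auto simp: numeral_2_eq_2 numeral_3_eq_3)

lemma arith_comp4:
  assumes "arith b n 4 (\<lambda>xs. P (xs ! 0) (xs ! 1) (xs ! 2) (xs ! 3))"
    and "total_rec k f" "total_rec k g" "total_rec k h" "total_rec k h'"
  shows "arith b n k (\<lambda>xs. P (f xs) (g xs) (h xs) (h' xs))"
  using arith_comp[of b n "[f, g, h, h']" "\<lambda>xs. P (xs ! 0) (xs ! 1) (xs ! 2) (xs ! 3)" k] assms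
  by (auto simp: numeral_2_eq_2 numeral_3_eq_3 eval_nat_numeral)

lemma arith_take:
  assumes "arith b n m P" "m \<le> k"
  shows "arith b n k (\<lambda>xs. P (take m xs))"
proof -
  have "arith b n (length (map (\<lambda>i xs. xs ! i) [0..<m])) P" using assms(1) by simp
  moreover have "total_rec k h" if "h \<in> set (map (\<lambda>i xs. xs ! i) [0..<m])" for h
    using that assms(2) by (auto simp: total_rec_nth)
  ultimately have "arith b n k (\<lambda>xs. P (map (\<lambda>h. h xs) (map (\<lambda>i xs. xs ! i) [0..<m])))"
    by (rule arith_comp)
  then have "arith b n k (\<lambda>xs. P (map ((!) xs) [0..<m]))" by (simp add: o_def)
  then show ?thesis
    by (rule arith_cong[THEN iffD1, rotated]) (use assms(2) in \<open>simp add: map_nth_upt0\<close>)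
qed

lemma arith_ex:
  assumes "arith False n (Suc k) (\<lambda>zs. P (take k zs) (zs ! k))"
  shows "arith True (Suc n) k (\<lambda>xs. \<exists>y. P xs y)"
  unfolding arith_Suc using assms
  by (intro exI[of _ "\<lambda>zs. P (take k zs) (zs ! k)"]) (simp add: nth_append)

lemma arith_Suc_dual: "arith (\<not> b) n k P \<Longrightarrow> arith b (Suc n) k P"
  unfolding arith_Suc using arith_take[of "\<not> b" n k P "Suc k"]
  by (intro exI[of _ "\<lambda>zs. P (take k zs)"]) simp

lemma arith_Suc_same: "arith b n k P \<Longrightarrow> arith b (Suc n) k P"
proof (induction n arbitrary: b k P)
  case 0
  then show ?case by (intro arith_Suc_dual) (simp add: arith_0)
next
  case (Suc n)
  then show ?case unfolding arith_Suc[of b] by blast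
qed

text \<open>Dummy quantifiers can be added in front or innermost, so above its own level a predicate
  is available with either polarity. This is how Delta classes are handled.\<close>

lemma arith_mono:
  assumes "arith b n k P" "n < m"
  shows "arith b' m k P"
proof -
  obtain l where l: "m = Suc l" "n \<le> l" using assms(2) by (cases m) auto
  have "arith b l k P" using l(2) assms(1)
    by (induction rule: dec_induct) (auto intro: arith_Suc_same)
  then show ?thesis using l(1) arith_Suc_same[of b l k P] arith_Suc_dual[of b' l k P]
    by (cases "b' = b") auto
qed

lemma arith_fst_snd:
  assumes "arith b n (Suc k) Q"
  shows "arith b n (Suc k) (\<lambda>zs. Q (take k zs @ [fst (prod_decode (zs ! k))]))"
    and "arith b n (Suc k) (\<lambda>zs. Q (take k zs @ [snd (prod_decode (zs ! k))]))"
proof -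
  have *: "arith b n (Suc k) (\<lambda>zs. Q (take k zs @ [h zs]))" if h: "total_rec (Suc k) h" for h
  proof -
    have "arith b n (length (map (\<lambda>i xs. xs ! i) [0..<k] @ [h])) Q" using assms by simp
    moreover have "total_rec (Suc k) g" if "g \<in> set (map (\<lambda>i xs. xs ! i) [0..<k] @ [h])" for g
      using that h by (auto simp: total_rec_nth)
    ultimately have "arith b n (Suc k)
        (\<lambda>xs. Q (map (\<lambda>h. h xs) (map (\<lambda>i xs. xs ! i) [0..<k] @ [h])))"
      by (rule arith_comp)
    then have "arith b n (Suc k) (\<lambda>xs. Q (map ((!) xs) [0..<k] @ [h xs]))" by (simp add: o_def)
    then show ?thesis by (rule arith_cong[THEN iffD1, rotated]) (simp add: map_nth_upt0)
  qed
  show "arith b n (Suc k) (\<lambda>zs. Q (take k zs @ [fst (prod_decode (zs ! k))]))"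
    and "arith b n (Suc k) (\<lambda>zs. Q (take k zs @ [snd (prod_decode (zs ! k))]))"
    by (intro * total_rec_fst_prod_decode total_rec_snd_prod_decode total_rec_nth; simp)+
qed

lemma ex_prod_decode: "(\<exists>w. R (fst (prod_decode w)) (snd (prod_decode w))) \<longleftrightarrow> (\<exists>y z. R y z)"
  by (metis fst_conv prod_encode_inverse snd_conv)

section \<open>Boolean operations and contraction of like quantifiers\<close>

lemma arith_conj:
  assumes "arith b n k P" "arith b n k Q"
  shows "arith b n k (\<lambda>xs. P xs \<and> Q xs)"
  using assms
proof (induction n arbitrary: b k P Q)
  case 0
  then show ?case by (simp add: arith_0 decidable_conj)
next
  case (Suc n)
  obtain P' where P': "arith (\<not> b) n (Suc k) P'"
    "\<And>xs. length xs = k \<Longrightarrow> P xs \<longleftrightarrow> (if b then \<exists>y. P' (xs @ [y]) else \<forall>y. P' (xs @ [y]))"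
    using Suc.prems(1) unfolding arith_Suc by blast
  obtain Q' where Q': "arith (\<not> b) n (Suc k) Q'"
    "\<And>xs. length xs = k \<Longrightarrow> Q xs \<longleftrightarrow> (if b then \<exists>y. Q' (xs @ [y]) else \<forall>y. Q' (xs @ [y]))"
    using Suc.prems(2) unfolding arith_Suc by blast
  show ?case
  proof (cases b)
    case True
    \<comment> \<open>The two existential witnesses are merged into one coded pair; a universal
      variable can simply be shared.\<close>
    let ?R = "\<lambda>zs. P' (take k zs @ [fst (prod_decode (zs ! k))]) \<and>
      Q' (take k zs @ [snd (prod_decode (zs ! k))])"
    have "arith (\<not> b) n (Suc k) ?R" by (intro Suc.IH arith_fst_snd P'(1) Q'(1))
    moreover have "P xs \<and> Q xs \<longleftrightarrow> (\<exists>y. ?R (xs @ [y]))" if "length xs = k" for xs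
      using that P'(2)[of xs] Q'(2)[of xs] True
        ex_prod_decode[of "\<lambda>y z. P' (xs @ [y]) \<and> Q' (xs @ [z])"]
      by (simp add: nth_append)
    ultimately show ?thesis unfolding arith_Suc using True by (intro exI[of _ ?R]) simp
  next
    case False
    have "arith (\<not> b) n (Suc k) (\<lambda>zs. P' zs \<and> Q' zs)" by (intro Suc.IH P'(1) Q'(1))
    then show ?thesis unfolding arith_Suc using False P'(2) Q'(2)
      by (intro exI[of _ "\<lambda>zs. P' zs \<and> Q' zs"]) auto
  qed
qed

lemma arith_disj:
  assumes "arith b n k P" "arith b n k Q"
  shows "arith b n k (\<lambda>xs. P xs \<or> Q xs)"
proof -
  have "arith (\<not> b) n k (\<lambda>xs. \<not> P xs)" "arith (\<not> b) n k (\<lambda>xs. \<not> Q xs)"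
    using assms arith_not[of "\<not> b" n k] by simp_all
  then have "arith b n k (\<lambda>xs. \<not> (\<not> P xs \<and> \<not> Q xs))" by (rule arith_not[OF arith_conj])
  then show ?thesis by simp
qed

lemma arith_imp:
  assumes "arith (\<not> b) n k P" "arith b n k Q"
  shows "arith b n k (\<lambda>xs. P xs \<longrightarrow> Q xs)"
  using arith_disj[OF arith_not[OF assms(1)] assms(2)] by simp

text \<open>The new witness and the one of the leading existential quantifier are coded as a single
  number.\<close>

lemma arith_ex_same:
  assumes "arith True (Suc n) (Suc k) (\<lambda>zs. P (take k zs) (zs ! k))"
  shows "arith True (Suc n) k (\<lambda>xs. \<exists>y. P xs y)"
proof -
  obtain Q where Q: "arith False n (Suc (Suc k)) Q"
    "\<And>zs. length zs = Suc k \<Longrightarrow> P (take k zs) (zs ! k) \<longleftrightarrow> (\<exists>y. Q (zs @ [y]))"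
    using assms unfolding arith_Suc by auto
  define gs where "gs = map (\<lambda>i zs. zs ! i) [0..<k] @
    [\<lambda>zs. fst (prod_decode (zs ! k)), \<lambda>zs. snd (prod_decode (zs ! k))]"
  have "total_rec (Suc k) g" if "g \<in> set gs" for g
    using that unfolding gs_def
    by (auto intro: total_rec_nth total_rec_fst_prod_decode total_rec_snd_prod_decode)
  moreover have "arith False n (length gs) Q" using Q(1) by (simp add: gs_def)
  ultimately have "arith False n (Suc k) (\<lambda>zs. Q (map (\<lambda>g. g zs) gs))" by (intro arith_comp)
  moreover have "(\<exists>y. P xs y) \<longleftrightarrow> (\<exists>w. Q (map (\<lambda>g. g (xs @ [w])) gs))" if "length xs = k" for xs
  proof -
    have "map (\<lambda>g. g (xs @ [w])) gs = xs @ [fst (prod_decode w), snd (prod_decode w)]" for w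
      using that by (auto simp: gs_def nth_append intro: nth_equalityI)
    moreover have "P xs y \<longleftrightarrow> (\<exists>z. Q (xs @ [y, z]))" for y
      using Q(2)[of "xs @ [y]"] that by (simp add: nth_append)
    ultimately show ?thesis using ex_prod_decode[of "\<lambda>y z. Q (xs @ [y, z])"] by simp
  qed
  ultimately show ?thesis
    unfolding arith_Suc by (intro exI[of _ "\<lambda>zs. Q (map (\<lambda>g. g zs) gs)"]) simp
qed

lemma arith_all_same:
  assumes "arith False (Suc n) (Suc k) (\<lambda>zs. P (take k zs) (zs ! k))"
  shows "arith False (Suc n) k (\<lambda>xs. \<forall>y. P xs y)"
proof -
  have "arith True (Suc n) (Suc k) (\<lambda>zs. \<not> P (take k zs) (zs ! k))"
    by (rule arith_not) (use assms in simp)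
  from arith_not[of False, simplified, OF arith_ex_same[where P = "\<lambda>xs y. \<not> P xs y", OF this]]
  show ?thesis by simp
qed

section \<open>The complexity of learnability\<close>

lemma eq_star_iff: "eq_star A B \<longleftrightarrow> (\<exists>m. \<forall>x. m \<le> x \<longrightarrow> (x \<in> A \<longleftrightarrow> x \<in> B))"
proof -
  have "finite S \<longleftrightarrow> (\<exists>m. \<forall>x. m \<le> x \<longrightarrow> x \<notin> S)" for S :: "nat set"
    unfolding finite_nat_set_iff_bounded by (auto simp: not_less[symmetric])
  from this[of "sym_diff A B"] show ?thesis unfolding eq_star_def by auto
qed

text \<open>One binary program enumerates all the sets, so a single clock provides the stages for
  every index.\<close>

lemma uniformly_ce_stages:
  assumes "uniformly_ce W"
  obtains T where "decidable 3 (\<lambda>xs. T (xs ! 0) (xs ! 1) (xs ! 2))"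
    and "\<And>i x. x \<in> W i \<longleftrightarrow> (\<exists>t. T i x t)"
    and "\<And>i x t t'. T i x t \<Longrightarrow> t \<le> t' \<Longrightarrow> T i x t'"
proof -
  obtain r where r: "\<And>i x. x \<in> W i \<longleftrightarrow> eval r [i, x] \<noteq> None"
    using assms unfolding uniformly_ce_def by blast
  obtain c where c: "clocked_eval 2 r c" using clocked_eval_exists by blast
  have "total_rec 3 (\<lambda>xs. c (xs ! 2) [xs ! 0, xs ! 1])"
    by (rule total_rec_clocked[where m = 2 and c = c and tf = "\<lambda>zs. zs ! 2"
          and gs = "[\<lambda>zs. zs ! 0, \<lambda>zs. zs ! 1]"])
      (use clocked_eval_total[OF c] in \<open>auto intro: total_rec_nth\<close>)
  then have "decidable 3 (\<lambda>xs. c (xs ! 2) [xs ! 0, xs ! 1] \<noteq> 0)"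
    by (intro decidable_not decidable_eq total_rec_const)
  moreover have "x \<in> W i \<longleftrightarrow> (\<exists>t. c t [i, x] \<noteq> 0)" for i x
    using clocked_eval_Some[OF c, of "[i, x]"] r[of x i]
    by (metis length_Cons list.size(3) not0_implies_Suc numeral_2_eq_2 option.exhaust_sel
        option.distinct(1) nat.distinct(1))
  moreover have "c t' [i, x] \<noteq> 0" if "c t [i, x] \<noteq> 0" "t \<le> t'" for i x t t'
    using clocked_eval_mono[OF c _ that] that(1) by simp
  ultimately show thesis by (rule that)
qed

text \<open>The graph is c.e.: wait for a stage at which the clock of the machine shows the required
  value. Acceptability of the numbering then yields an index.\<close>

lemma ex_graph_index:
  assumes W: "standard_numbering W" and M: "learning_machine M"
  shows "\<exists>a. \<forall>s v. prod_encode (list_encode s, v) \<in> W a \<longleftrightarrow> M s = Some v"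
proof -
  obtain r where r: "\<And>s. eval r [list_encode s] = M s"
    using M unfolding learning_machine_def by blast
  obtain c where c: "clocked_eval 1 r c" using clocked_eval_exists by blast
  let ?P = "\<lambda>xs t. c t [fst (prod_decode (xs ! 1))] = Suc (snd (prod_decode (xs ! 1)))"
  have "total_rec 3 (\<lambda>xs. c (xs ! 2) [fst (prod_decode (xs ! 1))])"
    by (rule total_rec_clocked[where m = 1 and c = c and tf = "\<lambda>zs. zs ! 2"
          and gs = "[\<lambda>zs. fst (prod_decode (zs ! 1))]"])
      (use clocked_eval_total[OF c] in \<open>auto intro!: total_rec_nth total_rec_fst_prod_decode\<close>)
  then have "decidable 3 (\<lambda>xs. c (xs ! 2) [fst (prod_decode (xs ! 1))] = Suc (snd (prod_decode (xs ! 1))))"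
    by (intro decidable_eq total_rec_Suc total_rec_snd_prod_decode total_rec_nth) auto
  then have dec: "decidable (Suc 2) (\<lambda>zs. ?P (take 2 zs) (zs ! 2))" by simp
  obtain q where q: "\<And>xs. length xs = 2 \<Longrightarrow>
      eval q xs = (if \<exists>t. ?P xs t then Some (LEAST t. ?P xs t) else None)"
    by (rule semidecidable_Mu[where P = ?P, OF dec]) (rule that)
  \<comment> \<open>Acceptability is stated for sequences, so the graph is entered as a constant
    sequence and its index is read off at 0.\<close>
  define V where "V = (\<lambda>_ :: nat. {z. eval r [fst (prod_decode z)] = Some (snd (prod_decode z))})"
  have "x \<in> V i \<longleftrightarrow> eval q [i, x] \<noteq> None" for i x
    using clocked_eval_Some[OF c, of "[fst (prod_decode x)]" "snd (prod_decode x)"] q[of "[i, x]"]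
    by (simp add: V_def)
  then have "uniformly_ce V" unfolding uniformly_ce_def by blast
  then obtain f where "\<And>i. W (f i) = V i" using W unfolding standard_numbering_def by blast
  then show ?thesis by (intro exI[of _ "f 0"]) (simp add: V_def r)
qed

section \<open>The formula for learnability and its complexity\<close>

context
  fixes p :: "nat \<Rightarrow> nat \<Rightarrow> nat" and W :: "nat \<Rightarrow> nat set" and T :: "nat \<Rightarrow> nat \<Rightarrow> nat \<Rightarrow> bool"
  assumes p: "pairing_function p" and W: "standard_numbering W"
    and T: "decidable 3 (\<lambda>xs. T (xs ! 0) (xs ! 1) (xs ! 2))"
    and W_iff: "\<And>i x. x \<in> W i \<longleftrightarrow> (\<exists>t. T i x t)"
    and T_mono: "\<And>i x t t'. T i x t \<Longrightarrow> t \<le> t' \<Longrightarrow> T i x t'"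
begin

lemma EXL_star_iff:
  "e \<in> EXL_star p W \<longleftrightarrow> (\<exists>a. \<forall>i.
     (\<exists>c. stabilizes (clocked_hyp (T a)) (column p W e i) (list_decode c)) \<and>
     (\<forall>c x. stabilizes (clocked_hyp (T a)) (column p W e i) (list_decode c) \<and>
        x \<in> column p W e i \<longrightarrow>
        eq_star (W (clocked_hyp (T a) (list_decode c))) (column p W e i)))"
  (is "_ \<longleftrightarrow> (\<exists>a. ?good a)")
proof
  assume "e \<in> EXL_star p W"
  then obtain M where M: "learning_machine M"
    and learn: "\<And>i. TxtEx_star_learns_set W M (column p W e i)"
    by (auto simp: EXL_star_def TxtEx_star_learnable_def TxtEx_star_learns_family_def uce_family_def)
  obtain a where a: "\<And>s v. prod_encode (list_encode s, v) \<in> W a \<longleftrightarrow> M s = Some v"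
    using ex_graph_index[OF W M] by blast
  have conv: "\<exists>n. (\<forall>\<^sub>F i in sequentially. clocked_hyp (T a) (initial_segment f i) = n) \<and>
      eq_star (W n) (column p W e i)" if f: "range f = column p W e i" for f i
  proof -
    obtain n where "\<forall>\<^sub>F i in sequentially. M (initial_segment f i) = Some n"
      and n: "eq_star (W n) (column p W e i)"
      using learn[of i] f unfolding TxtEx_star_learns_set_def TxtEx_star_identifies_def by metis
    moreover have "M s = Some v \<longleftrightarrow> (\<exists>t. T a (prod_encode (list_encode s, v)) t)" for s v
      using a W_iff by simp
    ultimately have "\<forall>\<^sub>F i in sequentially. clocked_hyp (T a) (initial_segment f i) = n"
      using clocked_hyp_converges[of M "T a" f n] T_mono by blast
    with n show ?thesis by blast
  qed
  have "?good a"
  proof (intro allI conjI impI)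
    fix i
    obtain s where "stabilizes (clocked_hyp (T a)) (column p W e i) s"
      using ex_stabilizes[of "column p W e i" "clocked_hyp (T a)"] conv[of _ i] by blast
    then show "\<exists>c. stabilizes (clocked_hyp (T a)) (column p W e i) (list_decode c)"
      by (metis list_encode_inverse)
  next
    fix i c x
    assume "stabilizes (clocked_hyp (T a)) (column p W e i) (list_decode c) \<and> x \<in> column p W e i"
    then show "eq_star (W (clocked_hyp (T a) (list_decode c))) (column p W e i)"
      using stabilizes_correct[of "column p W e i" "clocked_hyp (T a)" W] conv[of _ i] by blast
  qed
  then show "\<exists>a. ?good a" by (rule exI[of _ a])
next
  assume "\<exists>a. ?good a"
  then obtain a where a: "?good a" by (rule exE)
  let ?M = "\<lambda>s. Some (stab_learner (clocked_hyp (T a)) s)"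
  have "total_rec 1 (\<lambda>xs. clocked_hyp (T a) (list_decode (xs ! 0)))"
    by (intro total_rec_clocked_hyp[OF T] total_rec_const total_rec_nth) simp
  then have "total_rec 1 (\<lambda>xs. stab_learner (clocked_hyp (T a)) (list_decode (xs ! 0)))"
    by (rule total_rec_stab_learner)
  then obtain r where r: "\<And>xs. length xs = 1 \<Longrightarrow>
      eval r xs = Some (stab_learner (clocked_hyp (T a)) (list_decode (xs ! 0)))"
    unfolding total_rec_def by blast
  have "learning_machine ?M"
    unfolding learning_machine_def by (intro exI[of _ r]) (simp add: r)
  moreover have "TxtEx_star_identifies W ?M f" if f: "range f = column p W e i" for f i
  proof -
    have "\<exists>s. stabilizes (clocked_hyp (T a)) (column p W e i) s" using a by blast
    then obtain s where s: "stabilizes (clocked_hyp (T a)) (column p W e i) s"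
      and conv: "\<forall>\<^sub>F j in sequentially.
        stab_learner (clocked_hyp (T a)) (initial_segment f j) = clocked_hyp (T a) s"
      using stab_learner_converges[OF f] by blast
    \<comment> \<open>The mere existence of an enumeration shows the column to be nonempty, which
      discharges the guard.\<close>
    have "f 0 \<in> column p W e i" using f by blast
    moreover have "stabilizes (clocked_hyp (T a)) (column p W e i) (list_decode (list_encode s))"
      using s by simp
    ultimately have "eq_star (W (clocked_hyp (T a) (list_decode (list_encode s)))) (column p W e i)"
      using a by blast
    then show ?thesis
      unfolding TxtEx_star_identifies_def f using conv by (intro exI conjI) auto
  qed
  ultimately show "e \<in> EXL_star p W"
    unfolding EXL_star_def TxtEx_star_learnable_def TxtEx_star_learns_family_def uce_family_def
      TxtEx_star_learns_set_def by blast
qed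

lemma arith_mem_W:
  assumes "total_rec k e" "total_rec k x"
  shows "arith True 1 k (\<lambda>xs. x xs \<in> W (e xs))"
proof (rule arith_comp2[of True 1 "\<lambda>x e. x \<in> W e", OF _ assms(2,1)])
  have "arith True (Suc 0) 2 (\<lambda>xs. \<exists>t. T (xs ! 1) (xs ! 0) t)"
    by (rule arith_ex) (simp add: arith_0, intro decidable_comp3[OF T] total_rec_nth; simp)
  then show "arith True 1 2 (\<lambda>xs. xs ! 0 \<in> W (xs ! 1))" by (simp add: W_iff)
qed

lemma total_rec_pairing:
  "total_rec k f \<Longrightarrow> total_rec k g \<Longrightarrow> total_rec k (\<lambda>xs. p (f xs) (g xs))"
proof (rule total_rec_comp2[of p])
  obtain r where r: "\<And>x y. eval r [x, y] = Some (p x y)"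
    using p unfolding pairing_function_def computable2_def by blast
  show "total_rec 2 (\<lambda>xs. p (xs ! 0) (xs ! 1))"
    unfolding total_rec_def by (rule exI[of _ r]) (auto simp: r numeral_2_eq_2 length_Suc_conv)
qed

lemma arith_mem_column:
  assumes "total_rec k e" "total_rec k i" "total_rec k x"
  shows "arith True 1 k (\<lambda>xs. x xs \<in> column p W (e xs) (i xs))"
  unfolding column_def mem_Collect_eq by (intro arith_mem_W total_rec_pairing assms)

text \<open>Finitely many stages are replaced by their maximum, as stages are monotone. So the
  unbounded quantifier comes first, and the one over the entries stays inside the decidable
  matrix.\<close>

lemma arith_list_subset_column:
  assumes "total_rec k e" "total_rec k i" "total_rec k c"
  shows "arith True 1 k (\<lambda>xs. set (list_decode (c xs)) \<subseteq> column p W (e xs) (i xs))"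
proof (rule arith_comp3[of True 1 "\<lambda>e i c. set (list_decode c) \<subseteq> column p W e i", OF _ assms])
  have "arith True (Suc 0) 3 (\<lambda>xs. \<exists>t. \<forall>x\<in>set (list_decode (xs ! 2)). T (xs ! 0) (p (xs ! 1) x) t)"
    by (rule arith_ex)
      (simp add: arith_0, intro decidable_ball_list_decode decidable_comp3[OF T]
        total_rec_pairing total_rec_nth; simp add: total_rec_nth)
  moreover have "set (list_decode c) \<subseteq> column p W e i \<longleftrightarrow>
      (\<exists>t. \<forall>x\<in>set (list_decode c). T e (p i x) t)" for e i c
  proof
    assume "set (list_decode c) \<subseteq> column p W e i"
    then have "\<forall>x\<in>set (list_decode c). \<exists>t. T e (p i x) t" by (auto simp: column_def W_iff)
    then obtain t where t: "\<And>x. x \<in> set (list_decode c) \<Longrightarrow> T e (p i x) (t x)" by metis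
    have "T e (p i x) (Max (t ` set (list_decode c)))" if "x \<in> set (list_decode c)" for x
      by (rule T_mono[OF t[OF that]]) (use that in \<open>auto intro: Max_ge\<close>)
    then show "\<exists>t. \<forall>x\<in>set (list_decode c). T e (p i x) t" by blast
  qed (auto simp: column_def W_iff)
  ultimately show "arith True 1 3 (\<lambda>xs. set (list_decode (xs ! 2)) \<subseteq> column p W (xs ! 0) (xs ! 1))"
    by simp
qed

text \<open>The condition on extensions is Pi_1: its only undecidable premise is Sigma_1 and the
  values compared are total recursive. The polarity \<open>b\<close> is left open because the
  condition is used both under an existential quantifier and as a premise.\<close>

lemma arith_stabilizes:
  assumes "total_rec k e" "total_rec k a" "total_rec k i" "total_rec k c"
  shows "arith b 2 k (\<lambda>xs.
    stabilizes (clocked_hyp (T (a xs))) (column p W (e xs) (i xs)) (list_decode (c xs)))"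
proof (rule arith_comp4[of b 2 "\<lambda>e a i c. stabilizes (clocked_hyp (T a)) (column p W e i) (list_decode c)",
      OF _ assms])
  have all: "arith False (Suc 0) 4 (\<lambda>xs. \<forall>d. set (list_decode d) \<subseteq> column p W (xs ! 0) (xs ! 2) \<longrightarrow>
      prefix (list_decode (xs ! 3)) (list_decode d) \<longrightarrow>
      clocked_hyp (T (xs ! 1)) (list_decode d) = clocked_hyp (T (xs ! 1)) (list_decode (xs ! 3)))"
  proof (rule arith_all_same)
    have "arith False 1 5 (\<lambda>zs. set (list_decode (zs ! 4)) \<subseteq> column p W (zs ! 0) (zs ! 2) \<longrightarrow>
      prefix (list_decode (zs ! 3)) (list_decode (zs ! 4)) \<longrightarrow>
      clocked_hyp (T (zs ! 1)) (list_decode (zs ! 4)) = clocked_hyp (T (zs ! 1)) (list_decode (zs ! 3)))"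
    proof (rule arith_imp)
      show "arith (\<not> False) 1 5 (\<lambda>zs. set (list_decode (zs ! 4)) \<subseteq> column p W (zs ! 0) (zs ! 2))"
        by simp (intro arith_list_subset_column[unfolded One_nat_def] total_rec_nth; simp)
      show "arith False 1 5 (\<lambda>zs. prefix (list_decode (zs ! 3)) (list_decode (zs ! 4)) \<longrightarrow>
        clocked_hyp (T (zs ! 1)) (list_decode (zs ! 4)) = clocked_hyp (T (zs ! 1)) (list_decode (zs ! 3)))"
        by (rule arith_mono[of False 0], unfold arith_0, intro decidable_imp decidable_prefix
            decidable_eq total_rec_clocked_hyp[OF T] total_rec_nth) simp_all
    qed
    then show "arith False (Suc 0) (Suc 4) (\<lambda>zs.
      set (list_decode (zs ! 4)) \<subseteq> column p W (take 4 zs ! 0) (take 4 zs ! 2) \<longrightarrow>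
      prefix (list_decode (take 4 zs ! 3)) (list_decode (zs ! 4)) \<longrightarrow>
      clocked_hyp (T (take 4 zs ! 1)) (list_decode (zs ! 4)) =
      clocked_hyp (T (take 4 zs ! 1)) (list_decode (take 4 zs ! 3)))" by simp
  qed
  have "arith b 2 4 (\<lambda>xs. set (list_decode (xs ! 3)) \<subseteq> column p W (xs ! 0) (xs ! 2) \<and>
      (\<forall>d. set (list_decode d) \<subseteq> column p W (xs ! 0) (xs ! 2) \<longrightarrow>
        prefix (list_decode (xs ! 3)) (list_decode d) \<longrightarrow>
        clocked_hyp (T (xs ! 1)) (list_decode d) = clocked_hyp (T (xs ! 1)) (list_decode (xs ! 3))))"
    by (intro arith_conj arith_mono[of True 1, OF arith_list_subset_column]
        arith_mono[OF all] total_rec_nth) simp_all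
  \<comment> \<open>The hierarchy quantifies over numbers instead of lists; this loses nothing
    because \<open>list_decode\<close> is onto.\<close>
  moreover have "stabilizes N A s \<longleftrightarrow> set s \<subseteq> A \<and>
      (\<forall>d. set (list_decode d) \<subseteq> A \<longrightarrow> prefix s (list_decode d) \<longrightarrow> N (list_decode d) = N s)"
    (is "_ \<longleftrightarrow> _ \<and> ?R") for N A s
  proof -
    have "?R \<longleftrightarrow> (\<forall>u\<in>range list_decode. set u \<subseteq> A \<longrightarrow> prefix s u \<longrightarrow> N u = N s)" by blast
    then show ?thesis unfolding stabilizes_def by (simp add: surj_list_decode)
  qed
  ultimately show "arith b 2 4 (\<lambda>xs. stabilizes (clocked_hyp (T (xs ! 1)))
      (column p W (xs ! 0) (xs ! 2)) (list_decode (xs ! 3)))"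
    by simp
qed

text \<open>An equivalence of two Sigma_1 memberships uses both polarities and is therefore Delta_2.
  Read as Pi_2 it absorbs the quantifier over \<open>x\<close>, and the bound \<open>m\<close> adds
  the existential level.\<close>

lemma arith_eq_star_column:
  assumes "total_rec k n" "total_rec k e" "total_rec k i"
  shows "arith True 3 k (\<lambda>xs. eq_star (W (n xs)) (column p W (e xs) (i xs)))"
proof (rule arith_comp3[of True 3 "\<lambda>n e i. eq_star (W n) (column p W e i)", OF _ assms])
  have W: "arith b 2 5 (\<lambda>zs. zs ! 4 \<in> W (zs ! 0))" for b
    by (intro arith_mono[of True 1, OF arith_mem_W] total_rec_nth) simp_all
  have col: "arith b 2 5 (\<lambda>zs. zs ! 4 \<in> column p W (zs ! 1) (zs ! 2))" for b
    by (intro arith_mono[of True 1, OF arith_mem_column] total_rec_nth) simp_all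
  have le: "arith b 2 5 (\<lambda>zs. zs ! 3 \<le> zs ! 4)" for b
    by (rule arith_mono[of True 0], unfold arith_0, intro decidable_le total_rec_nth) simp_all
  have "arith False 2 5 (\<lambda>zs. zs ! 3 \<le> zs ! 4 \<longrightarrow>
      (zs ! 4 \<in> W (zs ! 0) \<longrightarrow> zs ! 4 \<in> column p W (zs ! 1) (zs ! 2)) \<and>
      (zs ! 4 \<in> column p W (zs ! 1) (zs ! 2) \<longrightarrow> zs ! 4 \<in> W (zs ! 0)))"
    by (intro arith_imp arith_conj W col le)
  then have "arith False (Suc 1) (Suc 4) (\<lambda>zs. take 4 zs ! 3 \<le> zs ! 4 \<longrightarrow>
      (zs ! 4 \<in> W (take 4 zs ! 0) \<longleftrightarrow> zs ! 4 \<in> column p W (take 4 zs ! 1) (take 4 zs ! 2)))"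
    by (simp add: iff_conv_conj_imp numeral_2_eq_2)
  then have "arith False (Suc 1) 4 (\<lambda>ys. \<forall>x. ys ! 3 \<le> x \<longrightarrow>
      (x \<in> W (ys ! 0) \<longleftrightarrow> x \<in> column p W (ys ! 1) (ys ! 2)))" by (rule arith_all_same)
  then have "arith False 2 (Suc 3) (\<lambda>ys. \<forall>x. ys ! 3 \<le> x \<longrightarrow>
      (x \<in> W (take 3 ys ! 0) \<longleftrightarrow> x \<in> column p W (take 3 ys ! 1) (take 3 ys ! 2)))"
    by (simp add: numeral_2_eq_2)
  then have "arith True (Suc 2) 3 (\<lambda>xs. \<exists>m. \<forall>x. m \<le> x \<longrightarrow>
      (x \<in> W (xs ! 0) \<longleftrightarrow> x \<in> column p W (xs ! 1) (xs ! 2)))" by (rule arith_ex)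
  then show "arith True 3 3 (\<lambda>xs. eq_star (W (xs ! 0)) (column p W (xs ! 1) (xs ! 2)))"
    by (simp add: eq_star_iff)
qed

lemma arith_EXL_star: "arith True 5 1 (\<lambda>xs. xs ! 0 \<in> EXL_star p W)"
proof -
  \<comment> \<open>Argument positions below: 0 is \<open>e\<close>, 1 is \<open>a\<close>, 2 is
    \<open>i\<close>, 3 is \<open>c\<close> and 4 is \<open>x\<close>.\<close>
  let ?stab = "\<lambda>e a i c. stabilizes (clocked_hyp (T a)) (column p W e i) (list_decode c)"
  let ?eq = "\<lambda>e a i c. eq_star (W (clocked_hyp (T a) (list_decode c))) (column p W e i)"
  have "arith True (Suc 1) (Suc 3) (\<lambda>zs. ?stab (take 3 zs ! 0) (take 3 zs ! 1) (take 3 zs ! 2) (zs ! 3))"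
    using arith_stabilizes[of "Suc 3" "\<lambda>zs. zs ! 0" "\<lambda>zs. zs ! 1" "\<lambda>zs. zs ! 2" "\<lambda>zs. zs ! 3" True]
    by (simp add: total_rec_nth numeral_2_eq_2[symmetric])
  then have "arith True (Suc 1) 3 (\<lambda>xs. \<exists>c. ?stab (xs ! 0) (xs ! 1) (xs ! 2) c)"
    by (rule arith_ex_same)
  then have ex: "arith False 4 3 (\<lambda>xs. \<exists>c. ?stab (xs ! 0) (xs ! 1) (xs ! 2) c)"
    by (rule arith_mono) simp
  have stab: "arith False 3 5 (\<lambda>zs. ?stab (zs ! 0) (zs ! 1) (zs ! 2) (zs ! 3))"
    by (intro arith_mono[of False 2, OF arith_stabilizes] total_rec_nth) simp_all
  have col: "arith False 3 5 (\<lambda>zs. zs ! 4 \<in> column p W (zs ! 0) (zs ! 2))"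
    by (intro arith_mono[of True 1, OF arith_mem_column] total_rec_nth) simp_all
  \<comment> \<open>The premise has to be of the dual class Pi_3 for the implication to remain
    Sigma_3.\<close>
  have "arith True 3 5 (\<lambda>zs. ?stab (zs ! 0) (zs ! 1) (zs ! 2) (zs ! 3) \<and>
      zs ! 4 \<in> column p W (zs ! 0) (zs ! 2) \<longrightarrow> ?eq (zs ! 0) (zs ! 1) (zs ! 2) (zs ! 3))"
    by (intro arith_imp arith_conj arith_eq_star_column total_rec_clocked_hyp[OF T] total_rec_nth)
      (simp_all add: stab[unfolded One_nat_def] col)
  \<comment> \<open>Sigma_3 is now read as Pi_4, the level at which the quantifiers over
    \<open>x\<close>, \<open>c\<close> and \<open>i\<close> are all absorbed.\<close>
  then have "arith False (Suc 3) (Suc 4) (\<lambda>zs.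
      ?stab (take 4 zs ! 0) (take 4 zs ! 1) (take 4 zs ! 2) (take 4 zs ! 3) \<and>
      zs ! 4 \<in> column p W (take 4 zs ! 0) (take 4 zs ! 2) \<longrightarrow>
      ?eq (take 4 zs ! 0) (take 4 zs ! 1) (take 4 zs ! 2) (take 4 zs ! 3))"
    using arith_Suc_dual[of False 3] by simp
  then have "arith False (Suc 3) 4 (\<lambda>ys. \<forall>x. ?stab (ys ! 0) (ys ! 1) (ys ! 2) (ys ! 3) \<and>
      x \<in> column p W (ys ! 0) (ys ! 2) \<longrightarrow> ?eq (ys ! 0) (ys ! 1) (ys ! 2) (ys ! 3))"
    by (rule arith_all_same)
  then have "arith False (Suc 3) (Suc 3) (\<lambda>ys. \<forall>x.
      ?stab (take 3 ys ! 0) (take 3 ys ! 1) (take 3 ys ! 2) (ys ! 3) \<and>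
      x \<in> column p W (take 3 ys ! 0) (take 3 ys ! 2) \<longrightarrow>
      ?eq (take 3 ys ! 0) (take 3 ys ! 1) (take 3 ys ! 2) (ys ! 3))"
    by simp
  then have "arith False (Suc 3) 3 (\<lambda>xs. \<forall>c x. ?stab (xs ! 0) (xs ! 1) (xs ! 2) c \<and>
      x \<in> column p W (xs ! 0) (xs ! 2) \<longrightarrow> ?eq (xs ! 0) (xs ! 1) (xs ! 2) c)"
    by (rule arith_all_same)
  then have "arith False 4 3 (\<lambda>xs. (\<exists>c. ?stab (xs ! 0) (xs ! 1) (xs ! 2) c) \<and>
      (\<forall>c x. ?stab (xs ! 0) (xs ! 1) (xs ! 2) c \<and>
        x \<in> column p W (xs ! 0) (xs ! 2) \<longrightarrow> ?eq (xs ! 0) (xs ! 1) (xs ! 2) c))"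
    by (intro arith_conj ex) simp
  then have "arith False (Suc 3) (Suc 2) (\<lambda>xs.
      (\<exists>c. ?stab (take 2 xs ! 0) (take 2 xs ! 1) (xs ! 2) c) \<and>
      (\<forall>c x. ?stab (take 2 xs ! 0) (take 2 xs ! 1) (xs ! 2) c \<and>
        x \<in> column p W (take 2 xs ! 0) (xs ! 2) \<longrightarrow> ?eq (take 2 xs ! 0) (take 2 xs ! 1) (xs ! 2) c))"
    by simp
  then have "arith False (Suc 3) 2 (\<lambda>xs. \<forall>i. (\<exists>c. ?stab (xs ! 0) (xs ! 1) i c) \<and>
      (\<forall>c x. ?stab (xs ! 0) (xs ! 1) i c \<and> x \<in> column p W (xs ! 0) i \<longrightarrow> ?eq (xs ! 0) (xs ! 1) i c))"
    by (rule arith_all_same)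
  then have "arith False 4 (Suc 1) (\<lambda>xs. \<forall>i. (\<exists>c. ?stab (take 1 xs ! 0) (xs ! 1) i c) \<and>
      (\<forall>c x. ?stab (take 1 xs ! 0) (xs ! 1) i c \<and> x \<in> column p W (take 1 xs ! 0) i \<longrightarrow>
        ?eq (take 1 xs ! 0) (xs ! 1) i c))"
    by (simp add: numeral_2_eq_2)
  then have "arith True (Suc 4) 1 (\<lambda>xs. \<exists>a. \<forall>i. (\<exists>c. ?stab (xs ! 0) a i c) \<and>
      (\<forall>c x. ?stab (xs ! 0) a i c \<and> x \<in> column p W (xs ! 0) i \<longrightarrow> ?eq (xs ! 0) a i c))"
    by (rule arith_ex)
  then show ?thesis by (simp add: EXL_star_iff)
qed

end

theorem theorem5p1:
  fixes p :: "nat \<Rightarrow> nat \<Rightarrow> nat" and W :: "nat \<Rightarrow> nat set"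
  assumes "pairing_function p"
    and "standard_numbering W"
  shows "Sigma0 5 (EXL_star p W)"
proof -
  have "uniformly_ce W" using assms(2) by (simp add: standard_numbering_def)
  then obtain T where T: "decidable 3 (\<lambda>xs. T (xs ! 0) (xs ! 1) (xs ! 2))"
    and W_iff: "\<And>i x. x \<in> W i \<longleftrightarrow> (\<exists>t. T i x t)"
    and T_mono: "\<And>i x t t'. T i x t \<Longrightarrow> t \<le> t' \<Longrightarrow> T i x t'"
    by (rule uniformly_ce_stages) blast
  have "arith True 5 1 (\<lambda>xs. xs ! 0 \<in> EXL_star p W)"
    by (rule arith_EXL_star[where T = T, OF assms T W_iff]) (rule T_mono)
  then obtain R where "decidable (1 + 5) R"
    and "\<And>xs. length xs = 1 \<Longrightarrow> xs ! 0 \<in> EXL_star p W \<longleftrightarrow> alternation True 5 R xs"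
    unfolding arith_def by blast
  then show ?thesis unfolding Sigma0_def by (intro exI[of _ R]) force
qed

end
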